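(* Let $m\ge2$, $W_i>0$ for all $i\in\{1,\dots,n_b\}$, $P^0\in\mathbb{R}^{n_b}$, $\sigma_{ij}>0$ for $(i,j)\in\mathcal{E}$, $\underline{P}_i\le\bar{P}_i$, and consider the optimization problem in the variables $P^{m-1},P^m\in\mathbb{R}^{n_b}$ $$\min\ \|W\circ(P^{m-1}-P^0)\|^2+\|W\circ(P^m-P^0)\|^2\quad\text{s.t.}\quad(\hat P^m_{ij})^2\le\sigma_{ij}^2\ \ \forall(i,j)\in\mathcal{E},\qquad \underline{P}_i\le P^k_i\le\bar{P}_i\ \ \forall i,\ k\in\{m-1,m\},$$ where $\hat P^m_{ij}$ is the linearized line power defined in the context. Assume the feasible region is nonempty, and let $(P^{m-1*},P^{m*})$ be the optimal solution. Let $$L=\sum_{k=m-1}^m\|W\circ(P^k-P^0)\|^2+\sum_{k=m-1}^{m}\sum_{i=1}^{n_b}\left[\bar\tau^k_i(P^k_i-\bar P_i)+\underline\tau^k_i(\underline P_i-P^k_i)\right]+\sum_{(i,j)\in\mathcal{E}}\lambda_{ij}\left[(\hat P^m_{ij})^2-\sigma_{ij}^2\right]$$ and consider the saddle point dynamics, for $k\in\{m-1,m\}$, $$\dot P^k=-\nabla_{P^k}L,\quad\dot\lambda_{ij}=\left[(\hat P^m_{ij})^2-\sigma_{ij}^2\right]^+_{\lambda_{ij}},\quad\dot{\bar\tau}^k_i=[P^k_i-\bar P_i]^+_{\bar\tau^k_i},\quad\dot{\underline\tau}^k_i=[\underline P_i-P^k_i]^+_{\underline\tau^k_i}.$$ Then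 the dynamics globally asymptotically converges to the optimal solution: for every initial condition with $P^{m-1}(0),P^m(0)\in\mathbb{R}^{n_b}$ and nonnegative initial $\lambda_{ij},\bar\tau^k_i,\underline\tau^k_i$, the (Carathéodory) solution satisfies $(P^{m-1}(t),P^m(t))\to(P^{m-1*},P^{m*})$ as $t\to\infty$.
   Context: The operator $[\,\cdot\,]^+$ is defined for scalars $x$ and $y\ge0$ by $[x]^+_y=x$ if $y>0$ and $[x]^+_y=\max\{x,0\}$ if $y=0$. A power network has $n_b$ buses and $n$ branches, with branch-bus incidence matrix $A\in\mathbb{R}^{n\times n_b}$; branch $l$ connects buses $i_l$ and $j_l$. $\mathcal{E}$ is the set of pairs $(i,j)$ of connected buses. $e_i\in\mathbb{R}^{n_b}$ is the $i$-th standard unit vector, $\mathrm{diag}(x)$ is the diagonal matrix with diagonal $x$, $\circ$ is the Hadamard (entrywise) product, $\|\cdot\|$ is the Euclidean norm. $M\mapsto M^{-1^*}$ is a fixed operator assigning to each (possibly singular) matrix $M\in\mathbb{R}^{n_b\times n_b}$ a (generalized inverse) matrix in $\mathbb{R}^{n_b\times n_b}$. For $Y\in\mathbb{R}^n$ define the row vector $$\mathcal{F}_{ij}(Y)=e_i^TA^T\mathrm{diag}(Y)Ae_j\,(e_i-e_j)^T(A^T\mathrm{diag}(Y)A)^{-1^*}.$$ Cascade. $g(p,c)=0$ if $|p|\ge\sqrt{c^2+\pi/(2\sigma)}$, $g(p,c)=1$ if $|p|\le\sqrt{c^2-\pi/(2\sigma)}$, and $g(p,c)=\frac12\left(1-\sin(\sigma[p^2-c^2])\right)$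 otherwise, where $\sigma>0$ is a parameter and $c_{ij}$ is the power threshold of line $(i,j)$; $g'$ denotes the derivative in $p$. $Y_p^1\in\mathbb{R}^n$ is the given branch admittance vector after the initial disturbance. Using the original injections $P^0$, put $Y^{k+1}_{p,l}=g(\mathcal{F}_{i_lj_l}(Y_p^k)P^0,c_{i_lj_l})\,Y^k_{p,l}$ for $l=1,\dots,n$ and $k=1,\dots,m-2$, which fixes $Y_p^{m-1}$, and denote by $Y_p^m|_{P^0}$ the vector obtained by applying the same formula once more with $k=m-1$. Linearized line power. For $(i,j)\in\mathcal{E}$, $$\hat P^m_{ij}=\sum_{l=1}^n\frac{\partial\left[\mathcal{F}_{ij}(Y)P^0\right]}{\partial Y_l}\Big|_{Y=Y_p^m|_{P^0}}\,g'\!\left(\mathcal{F}_{i_lj_l}(Y_p^{m-1})P^0,c_{i_lj_l}\right)Y^{m-1}_{p,l}\,\mathcal{F}_{i_lj_l}(Y_p^{m-1})(P^{m-1}-P^0)+\mathcal{F}_{ij}(Y_p^m|_{P^0})P^m,$$ i.e. the first-order approximation at $(P^0,P^0)$ of the line power $P^m_{ij}$ at step $m$ as a function of $(P^{m-1},P^m)$; the partial derivatives appearing are assumed to exist. *)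

theory Defs
  imports "HOL-Analysis.Analysis"
begin

section \<open>Power networks and cascades\<close>

text \<open>
  The index type \<open>'b\<close> stands for the \<open>n\<^sub>b\<close> buses and \<open>'l\<close> for the \<open>n\<close> branches.
  \<open>geninv\<close> is the operator \<open>M \<mapsto> M\<^sup>-\<^sup>1\<^sup>*\<close>; nothing is required of it.
\<close>

record ('b::finite, 'l::finite) network =
  inc :: "real ^ 'b ^ 'l"
  bus_i :: "'l \<Rightarrow> 'b"
  bus_j :: "'l \<Rightarrow> 'b"
  lines :: "('b \<times> 'b) set"
  geninv :: "real ^ 'b ^ 'b \<Rightarrow> real ^ 'b ^ 'b"
  threshold :: "'b \<Rightarrow> 'b \<Rightarrow> real"
  steepness :: real
  adm_init :: "real ^ 'l"

text \<open>
  The branches may be oriented arbitrarily in the incidence matrix. The set of pairs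
  \<open>lines\<close> must contain every pair of connected buses in at least one of its two orders and
  nothing else, so it may list each line once or in both orders.
\<close>

definition valid_network :: "('b::finite, 'l::finite) network \<Rightarrow> bool" where
  "valid_network N \<longleftrightarrow>
     (\<forall>l. inc N $ l = axis (bus_i N l) 1 - axis (bus_j N l) 1 \<or>
          inc N $ l = axis (bus_j N l) 1 - axis (bus_i N l) 1) \<and>
     (\<lambda>(i, j). {i, j}) ` lines N = range (\<lambda>l. {bus_i N l, bus_j N l}) \<and>
     steepness N > 0"

definition diag_matrix :: "real ^ 'n \<Rightarrow> real ^ 'n ^ 'n" where
  "diag_matrix x = (\<chi> i j. if i = j then x $ i else 0)"

definition laplacian :: "('b::finite, 'l::finite) network \<Rightarrow> real ^ 'l \<Rightarrow> real ^ 'b ^ 'b" where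
  "laplacian N Y = transpose (inc N) ** diag_matrix Y ** inc N"

text \<open>The row vector \<open>\<F>\<^sub>i\<^sub>j(Y)\<close>; its product with a column vector \<open>P\<close> is \<open>flow N i j Y \<bullet> P\<close>.\<close>

definition flow :: "('b::finite, 'l::finite) network \<Rightarrow> 'b \<Rightarrow> 'b \<Rightarrow> real ^ 'l \<Rightarrow> real ^ 'b" where
  "flow N i j Y =
     (axis i 1 \<bullet> (laplacian N Y *v axis j 1)) *\<^sub>R
     ((axis i 1 - axis j 1) v* geninv N (laplacian N Y))"

text \<open>
  \<open>trip s p c\<close> is \<open>g(p, c)\<close> with parameter \<open>s\<close>. If \<open>c\<^sup>2 < pi / (2 * s)\<close>, the HOL value of the
  second square root is negative, so the second case never applies.
\<close>

definition trip :: "real \<Rightarrow> real \<Rightarrow> real \<Rightarrow> real" where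
  "trip s p c =
     (if \<bar>p\<bar> \<ge> sqrt (c\<^sup>2 + pi / (2 * s)) then 0
      else if \<bar>p\<bar> \<le> sqrt (c\<^sup>2 - pi / (2 * s)) then 1
      else (1 - sin (s * (p\<^sup>2 - c\<^sup>2))) / 2)"

definition cascade_step ::
    "('b::finite, 'l::finite) network \<Rightarrow> real ^ 'b \<Rightarrow> real ^ 'l \<Rightarrow> real ^ 'l" where
  "cascade_step N P Y =
     (\<chi> l. trip (steepness N) (flow N (bus_i N l) (bus_j N l) Y \<bullet> P)
              (threshold N (bus_i N l) (bus_j N l)) * Y $ l)"

text \<open>
  The admittances \<open>Y\<^sub>p\<^sup>k\<close> for \<open>k \<ge> 1\<close> with the injections kept at \<open>P0\<close>; in particular
  \<open>admittance N P0 m\<close> is \<open>Y\<^sub>p\<^sup>m\<close> evaluated at \<open>P0\<close>.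
\<close>

definition admittance ::
    "('b::finite, 'l::finite) network \<Rightarrow> real ^ 'b \<Rightarrow> nat \<Rightarrow> real ^ 'l" where
  "admittance N P0 k = (cascade_step N P0 ^^ (k - 1)) (adm_init N)"

definition has_partial :: "(real ^ 'n \<Rightarrow> real) \<Rightarrow> 'n \<Rightarrow> real ^ 'n \<Rightarrow> bool" where
  "has_partial f l Y \<longleftrightarrow> (\<lambda>t. f (Y + t *\<^sub>R axis l 1)) differentiable (at 0)"

definition partial_deriv :: "(real ^ 'n \<Rightarrow> real) \<Rightarrow> 'n \<Rightarrow> real ^ 'n \<Rightarrow> real" where
  "partial_deriv f l Y = deriv (\<lambda>t. f (Y + t *\<^sub>R axis l 1)) 0"

text \<open>
  The linearized line power. Injections are families \<open>P :: nat \<Rightarrow> real ^ 'b\<close> indexed by the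
  cascade step, of which only the members \<open>m - 1\<close> and \<open>m\<close> matter here and below.
\<close>

definition lin_power ::
    "('b::finite, 'l::finite) network \<Rightarrow> real ^ 'b \<Rightarrow> nat \<Rightarrow> 'b \<Rightarrow> 'b \<Rightarrow> (nat \<Rightarrow> real ^ 'b) \<Rightarrow> real" where
  "lin_power N P0 m i j P =
     (\<Sum>l\<in>UNIV.
        (let Y' = admittance N P0 (m - 1); F = flow N (bus_i N l) (bus_j N l) Y' in
         partial_deriv (\<lambda>Y. flow N i j Y \<bullet> P0) l (admittance N P0 m) *
         deriv (\<lambda>p. trip (steepness N) p (threshold N (bus_i N l) (bus_j N l))) (F \<bullet> P0) *
         Y' $ l * (F \<bullet> (P (m - 1) - P0)))) +
     flow N i j (admittance N P0 m) \<bullet> P m"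

section \<open>The optimization problem and its Lagrangian\<close>

text \<open>Multiplication of vectors of type \<open>real ^ 'b\<close> is the Hadamard product.\<close>

definition objective ::
    "real ^ 'b \<Rightarrow> real ^ 'b \<Rightarrow> nat \<Rightarrow> (nat \<Rightarrow> real ^ 'b) \<Rightarrow> real" where
  "objective W P0 m P = (\<Sum>k = m - 1..m. (norm (W * (P k - P0)))\<^sup>2)"

definition feasible ::
    "('b::finite, 'l::finite) network \<Rightarrow> real ^ 'b \<Rightarrow> nat \<Rightarrow> ('b \<Rightarrow> 'b \<Rightarrow> real) \<Rightarrow>
     real ^ 'b \<Rightarrow> real ^ 'b \<Rightarrow> (nat \<Rightarrow> real ^ 'b) \<Rightarrow> bool" where
  "feasible N P0 m \<sigma> lo hi P \<longleftrightarrow>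
     (\<forall>(i, j)\<in>lines N. (lin_power N P0 m i j P)\<^sup>2 \<le> (\<sigma> i j)\<^sup>2) \<and>
     (\<forall>k\<in>{m - 1..m}. \<forall>i. lo $ i \<le> P k $ i \<and> P k $ i \<le> hi $ i)"

text \<open>
  \<open>lam\<close> holds the multipliers of the line constraints, \<open>\<tau>u\<close> and \<open>\<tau>l\<close> those of the upper and of
  the lower bounds.
\<close>

definition lagrangian ::
    "('b::finite, 'l::finite) network \<Rightarrow> real ^ 'b \<Rightarrow> real ^ 'b \<Rightarrow> nat \<Rightarrow> ('b \<Rightarrow> 'b \<Rightarrow> real) \<Rightarrow>
     real ^ 'b \<Rightarrow> real ^ 'b \<Rightarrow> (nat \<Rightarrow> real ^ 'b) \<Rightarrow>
     ('b \<Rightarrow> 'b \<Rightarrow> real) \<Rightarrow> (nat \<Rightarrow> 'b \<Rightarrow> real) \<Rightarrow> (nat \<Rightarrow> 'b \<Rightarrow> real) \<Rightarrow> real" where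
  "lagrangian N W P0 m \<sigma> lo hi P lam \<tau>u \<tau>l =
     (\<Sum>k = m - 1..m. (norm (W * (P k - P0)))\<^sup>2) +
     (\<Sum>k = m - 1..m. \<Sum>i\<in>UNIV. \<tau>u k i * (P k $ i - hi $ i) + \<tau>l k i * (lo $ i - P k $ i)) +
     (\<Sum>(i, j)\<in>lines N. lam i j * ((lin_power N P0 m i j P)\<^sup>2 - (\<sigma> i j)\<^sup>2))"

section \<open>Saddle point dynamics\<close>

text \<open>
  \<open>pos_proj x y\<close> is \<open>[x]\<^sup>+\<^sub>y\<close>. That operator is defined for \<open>y \<ge> 0\<close> only; the extension to
  \<open>y < 0\<close> chosen here keeps a multiplier with nonnegative initial value nonnegative.
\<close>

definition pos_proj :: "real \<Rightarrow> real \<Rightarrow> real" where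
  "pos_proj x y = (if y > 0 then x else max x 0)"

definition gradient :: "('a::real_inner \<Rightarrow> real) \<Rightarrow> 'a \<Rightarrow> 'a" where
  "gradient f x = (THE D. GDERIV f x :> D)"

definition abs_continuous_on :: "real \<Rightarrow> real \<Rightarrow> (real \<Rightarrow> 'a::real_normed_vector) \<Rightarrow> bool" where
  "abs_continuous_on a b x \<longleftrightarrow>
     (\<forall>\<epsilon>>0. \<exists>\<delta>>0. \<forall>D. finite D \<and> (\<forall>(u, v)\<in>D. a \<le> u \<and> u \<le> v \<and> v \<le> b) \<and>
        pairwise (\<lambda>(u, v) (u', v'). disjnt {u<..<v} {u'<..<v'}) D \<and>
        (\<Sum>(u, v)\<in>D. v - u) < \<delta> \<longrightarrow>
        (\<Sum>(u, v)\<in>D. norm (x v - x u)) < \<epsilon>)"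

text \<open>
  \<open>x' = rhs\<close> on \<open>[0, \<infinity>)\<close> in the sense of Caratheodory, for one component \<open>x\<close> of a trajectory;
  \<open>rhs t\<close> is the vector field component evaluated along the trajectory at time \<open>t\<close>.
\<close>

definition caratheodory :: "(real \<Rightarrow> 'a::real_normed_vector) \<Rightarrow> (real \<Rightarrow> 'a) \<Rightarrow> bool" where
  "caratheodory x rhs \<longleftrightarrow>
     (\<forall>T>0. abs_continuous_on 0 T x) \<and>
     (AE t in lebesgue. t > 0 \<longrightarrow> (x has_vector_derivative rhs t) (at t))"

definition saddle_solution ::
    "('b::finite, 'l::finite) network \<Rightarrow> real ^ 'b \<Rightarrow> real ^ 'b \<Rightarrow> nat \<Rightarrow> ('b \<Rightarrow> 'b \<Rightarrow> real) \<Rightarrow>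
     real ^ 'b \<Rightarrow> real ^ 'b \<Rightarrow> (real \<Rightarrow> nat \<Rightarrow> real ^ 'b) \<Rightarrow>
     (real \<Rightarrow> 'b \<Rightarrow> 'b \<Rightarrow> real) \<Rightarrow> (real \<Rightarrow> nat \<Rightarrow> 'b \<Rightarrow> real) \<Rightarrow> (real \<Rightarrow> nat \<Rightarrow> 'b \<Rightarrow> real) \<Rightarrow> bool" where
  "saddle_solution N W P0 m \<sigma> lo hi P lam \<tau>u \<tau>l \<longleftrightarrow>
     (\<forall>k\<in>{m - 1..m}. caratheodory (\<lambda>t. P t k)
        (\<lambda>t. - gradient (\<lambda>p. lagrangian N W P0 m \<sigma> lo hi ((P t)(k := p)) (lam t) (\<tau>u t) (\<tau>l t)) (P t k))) \<and>
     (\<forall>(i, j)\<in>lines N. caratheodory (\<lambda>t. lam t i j)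
        (\<lambda>t. pos_proj ((lin_power N P0 m i j (P t))\<^sup>2 - (\<sigma> i j)\<^sup>2) (lam t i j))) \<and>
     (\<forall>k\<in>{m - 1..m}. \<forall>i. caratheodory (\<lambda>t. \<tau>u t k i)
        (\<lambda>t. pos_proj (P t k $ i - hi $ i) (\<tau>u t k i))) \<and>
     (\<forall>k\<in>{m - 1..m}. \<forall>i. caratheodory (\<lambda>t. \<tau>l t k i)
        (\<lambda>t. pos_proj (lo $ i - P t k $ i) (\<tau>l t k i)))"

end

theory Submission
  imports Defs
begin

text \<open>
  The linearized line power is an affine function of \<open>(P\<^sup>m\<^sup>-\<^sup>1, P\<^sup>m)\<close>, so the problem minimizes a
  strongly convex quadratic under affine inequalities (the box bounds) and bands
  \<open>(n \<bullet> z + c)\<^sup>2 \<le> s\<^sup>2\<close> with \<open>s > 0\<close> (the lines). The proof compares the trajectory with a saddle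
  point of the Lagrangian through the distance
  \<open>V = \<parallel>x - x\<^sup>*\<parallel>\<^sup>2 + \<Sum> (\<mu>\<^sub>j - \<mu>\<^sub>j\<^sup>*)\<^sup>2\<close>.

  A saddle point exists although the feasible set may have empty interior (\<open>lo = hi\<close> is
  possible, so Slater's condition may fail): the feasible set is a polyhedron, and since \<open>s > 0\<close>
  the squared constraints have nonzero gradients wherever they are active. Hence every direction
  in which no active constraint increases to first order stays feasible for a short time
  (\<open>affine_or_band_feasible_direction\<close>), and separating the negative gradient from the finitely
  generated cone of active constraint gradients gives multipliers \<open>\<mu>\<^sup>*\<close>
  (\<open>karush_kuhn_tucker\<close>).

  Along the dynamics the multipliers stay nonnegative, and convexity of the constraints with strong
  monotonicity of the gradient of the objective gives \<open>V' \<le> - 2 c \<parallel>x - x\<^sup>*\<parallel>\<^sup>2\<close>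
  (\<open>saddle_dissipation\<close>). Hence \<open>V\<close> is nonincreasing, the trajectory is bounded, and the squared
  distance \<open>\<phi> = \<parallel>x - x\<^sup>*\<parallel>\<^sup>2\<close> is Lipschitz. Were \<open>\<phi>\<close> to return to a value \<open>\<ge> \<epsilon>\<close> at
  arbitrarily late times, it would remain above \<open>\<epsilon> / 2\<close> for a fixed duration each time, and
  \<open>V\<close> would drop by a fixed amount infinitely often
  (\<open>dissipated_quantity_tendsto_0\<close>).

  Caratheodory solutions satisfy the equation only almost everywhere. The one fact from real
  analysis that this requires is \<open>abs_continuous_increment_le\<close>: an absolutely continuous function
  whose derivative is at most \<open>B\<close> almost everywhere grows at rate at most \<open>B\<close>.
\<close>

section \<open>Growth of absolutely continuous functions\<close>

text \<open>
  The straddle form of differentiability: because \<open>t\<close> lies between \<open>u\<close> and \<open>v\<close>, the errors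
  at the two ends are proportional to \<open>v - t\<close> and \<open>t - u\<close> and add up to one proportional to
  \<open>v - u\<close>. This is what a gauge for tagged divisions needs.
\<close>

lemma straddle_increment_le:
  fixes f :: "real \<Rightarrow> real"
  assumes "(f has_real_derivative D) (at t)" "D \<le> B" "e > 0"
  shows "\<exists>d>0. \<forall>u v. u \<le> t \<longrightarrow> t \<le> v \<longrightarrow> u \<in> ball t d \<longrightarrow> v \<in> ball t d \<longrightarrow>
           f v - f u \<le> (B + e) * (v - u)"
proof -
  have "(f has_derivative (\<lambda>h. h * D)) (at t)"
    using assms(1) by (simp add: has_field_derivative_def mult_commute_abs)
  then obtain d where d: "d > 0"
    "\<And>y. norm (y - t) < d \<Longrightarrow> norm (f y - f t - (y - t) * D) \<le> e * norm (y - t)"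
    using assms(3) unfolding has_derivative_at_alt by blast
  show ?thesis
  proof (intro exI[of _ d] conjI allI impI)
    fix u v assume uv: "u \<le> t" "t \<le> v" "u \<in> ball t d" "v \<in> ball t d"
    have "\<bar>f v - f t - (v - t) * D\<bar> \<le> e * (v - t)" "\<bar>f u - f t - (u - t) * D\<bar> \<le> e * (t - u)"
      using d(2)[of v] d(2)[of u] uv by (auto simp: dist_real_def)
    then have "f v - f u \<le> (v - u) * D + e * (v - u)"
      by (simp add: algebra_simps abs_le_iff)
    also have "\<dots> \<le> (v - u) * B + e * (v - u)"
      using uv assms(2) by (intro add_right_mono mult_left_mono) auto
    finally show "f v - f u \<le> (B + e) * (v - u)" by (simp add: algebra_simps)
  qed (use d in auto)
qed

lemma sum_lengths_le_measure:
  fixes D :: "(real \<times> real) set"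
  assumes "finite D" "\<And>u v. (u, v) \<in> D \<Longrightarrow> u \<le> v \<and> {u..v} \<subseteq> U" "U \<in> lmeasurable"
    and dj: "pairwise (\<lambda>(u, v) (u', v'). disjnt {u<..<v} {u'<..<v'}) D"
  shows "(\<Sum>(u, v)\<in>D. v - u) \<le> measure lebesgue U"
proof -
  let ?I = "\<lambda>(u, v). {u<..<v::real}"
  have "disjoint_family_on ?I D"
    using dj by (fastforce simp: disjoint_family_on_def pairwise_def disjnt_def)
  then have "measure lebesgue (\<Union>(?I ` D)) = (\<Sum>d\<in>D. measure lebesgue (?I d))"
    using assms(1,2) by (intro measure_finite_Union) (auto simp: less_top[symmetric])
  also have "\<dots> = (\<Sum>(u, v)\<in>D. v - u)"
    using assms(2) by (intro sum.cong) auto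
  finally have "(\<Sum>(u, v)\<in>D. v - u) = measure lebesgue (\<Union>(?I ` D))" by simp
  also have "\<dots> \<le> measure lebesgue U"
    using assms(1,2,3) by (intro measure_mono_fmeasurable) (fastforce intro!: sets.finite_UN)+
  finally show ?thesis .
qed

text \<open>
  A Henstock argument. The exceptional null set is covered by an open set \<open>U\<close> of small
  measure. Over a tagged division fine for a suitable gauge, intervals tagged at good points
  contribute at most \<open>(B + e) (v - u)\<close>, while those tagged at exceptional points lie in \<open>U\<close>;
  their total length is below \<open>\<eta>\<close>, so absolute continuity bounds the total oscillation
  over them.
\<close>

lemma abs_continuous_increment_le:
  fixes f :: "real \<Rightarrow> real"
  assumes ab: "a \<le> b" and ac: "abs_continuous_on a b f"
    and ae: "AE t in lebesgue. t \<in> {a<..<b} \<longrightarrow> (\<exists>D\<le>B. (f has_real_derivative D) (at t))"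
  shows "f b - f a \<le> B * (b - a)"
proof (rule field_le_epsilon)
  fix \<epsilon> :: real assume "\<epsilon> > 0"
  define e where "e = \<epsilon> / (b - a + 2)"
  have e: "e > 0" using \<open>\<epsilon> > 0\<close> ab by (simp add: e_def)
  obtain N where N: "N \<in> null_sets lebesgue"
    "{t. \<not> (t \<in> {a<..<b} \<longrightarrow> (\<exists>D\<le>B. (f has_real_derivative D) (at t)))} \<subseteq> N"
    using ae by (auto simp: eventually_ae_filter)
  \<comment> \<open>The end points are exceptional too, as the derivative is controlled only inside.\<close>
  define N' where "N' = insert a (insert b N)"
  have N': "negligible N'"
    using N(1) by (auto simp: N'_def negligible_iff_null_sets)
  obtain \<delta> where \<delta>: "\<delta> > 0" "\<And>D. finite D \<Longrightarrow> (\<And>u v. (u, v)\<in>D \<Longrightarrow> a \<le> u \<and> u \<le> v \<and> v \<le> b) \<Longrightarrow>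
        pairwise (\<lambda>(u, v) (u', v'). disjnt {u<..<v} {u'<..<v'}) D \<Longrightarrow>
        (\<Sum>(u, v)\<in>D. v - u) < \<delta> \<Longrightarrow> (\<Sum>(u, v)\<in>D. norm (f v - f u)) < e"
    using ac e unfolding abs_continuous_on_def by (smt (verit, best) case_prodI2)
  \<comment> \<open>Half of \<open>\<delta>\<close> to meet the absolute continuity modulus; the other bound makes the linear
    term lost on the exceptional intervals at most \<open>e\<close>.\<close>
  define \<eta> where "\<eta> = min (\<delta> / 2) (e / (\<bar>B + e\<bar> + 1))"
  have \<eta>: "\<eta> > 0" "\<eta> < \<delta>" "\<bar>B + e\<bar> * \<eta> \<le> e"
  proof -
    show "\<eta> > 0" "\<eta> < \<delta>" using \<delta>(1) e by (auto simp: \<eta>_def)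
    have "\<bar>B + e\<bar> * \<eta> \<le> \<bar>B + e\<bar> * (e / (\<bar>B + e\<bar> + 1))"
      by (intro mult_left_mono) (auto simp: \<eta>_def)
    also have "\<dots> \<le> e" using e by (simp add: field_simps)
    finally show "\<bar>B + e\<bar> * \<eta> \<le> e" .
  qed
  obtain U where U: "open U" "N' \<subseteq> U" "U \<in> lmeasurable" "measure lebesgue U < \<eta>"
  proof -
    have N'l: "N' \<in> lmeasurable" "measure lebesgue N' = 0"
      using N' by (auto simp: negligible_imp_measurable negligible_imp_measure0)
    obtain U where "open U" "N' \<subseteq> U" "U - N' \<in> lmeasurable" "emeasure lebesgue (U - N') < ennreal \<eta>"
      using sets_lebesgue_outer_open[of N' \<eta>] N'l \<eta> by (auto simp: fmeasurableD)
    moreover have "U \<in> lmeasurable"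
      using calculation N'l by (metis Diff_partition fmeasurable.Un)
    moreover have "measure lebesgue U = measure lebesgue (U - N')"
      using N' calculation by (metis measure_Diff_null_set negligible_iff_null_sets fmeasurableD)
    ultimately show ?thesis
      using that \<eta>(1) by (metis emeasure_eq_measure2 ennreal_less_iff measure_nonneg)
  qed
  have "\<exists>d>0. \<forall>u v. u \<le> t \<longrightarrow> t \<le> v \<longrightarrow> u \<in> ball t d \<longrightarrow> v \<in> ball t d \<longrightarrow>
           f v - f u \<le> (B + e) * (v - u)" if "t \<in> {a..b} - N'" for t
  proof -
    have "t \<in> {a<..<b}" "t \<notin> N" using that by (auto simp: N'_def)
    then obtain D where "D \<le> B" "(f has_real_derivative D) (at t)" using N(2) by auto
    then show ?thesis using straddle_increment_le e by blast
  qed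
  then obtain d where d: "\<And>t. t \<in> {a..b} - N' \<Longrightarrow> d t > 0"
    "\<And>t u v. t \<in> {a..b} - N' \<Longrightarrow> u \<le> t \<Longrightarrow> t \<le> v \<Longrightarrow> u \<in> ball t (d t) \<Longrightarrow> v \<in> ball t (d t) \<Longrightarrow>
           f v - f u \<le> (B + e) * (v - u)"
    by metis
  define g where "g t = (if t \<in> N' then U else if t \<in> {a..b} then ball t (d t) else ball t 1)" for t
  have "gauge g" unfolding gauge_def
    using U d(1) by (auto simp: g_def)
  then obtain p where p: "p tagged_division_of {a..b}" "g fine p"
    by (rule fine_division_exists_real)
  have pI: "K = {Inf K..Sup K} \<and> Inf K \<le> x \<and> x \<le> Sup K \<and> a \<le> Inf K \<and> Sup K \<le> b \<and> K \<subseteq> g x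
     \<and> interior K = {Inf K<..<Sup K}"
    if xK: "(x, K) \<in> p" for x K
  proof -
    obtain u v where K: "K = cbox u v"
      using tagged_division_ofD(4)[OF p(1) xK] by blast
    have x: "x \<in> K" "K \<subseteq> {a..b}" using tagged_division_ofD(2,3)[OF p(1) that] by auto
    have "u \<le> v" using K x by auto
    then show ?thesis using K x p(2) that by (auto simp: fine_def)
  qed
  let ?ends = "\<lambda>(x, K). (Inf K, Sup (K::real set))"
  have disj: "disjnt {Inf K<..<Sup K} {Inf K'<..<Sup K'}"
    if "(x, K) \<in> p" "(x', K') \<in> p" "(x, K) \<noteq> (x', K')" for x x' K K'
    using tagged_division_ofD(5)[OF p(1) that] pI that(1,2) by (metis disjnt_def)
  \<comment> \<open>Absolute continuity speaks of sets of pairs of end points, so distinct tagged intervals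
    must give distinct pairs; a degenerate interval determines its tag.\<close>
  have inj: "inj_on ?ends p"
  proof (rule inj_onI, clarify)
    fix x K x' K' assume A: "(x, K) \<in> p" "(x', K') \<in> p" "Inf K = Inf K'" "Sup K = Sup K'"
    have KK: "K = K'" using pI A by metis
    \<comment> \<open>Different tags would make the common interior empty, forcing a one-point interval.\<close>
    have "x = x'"
    proof (rule ccontr)
      assume "x \<noteq> x'"
      then have "\<not> Inf K < Sup K" using disj[OF A(1,2)] A(3,4) by (auto simp: disjnt_def)
      then show False using pI[OF A(1)] pI[OF A(2)] A(3,4) \<open>x \<noteq> x'\<close> by auto
    qed
    then show "x = x' \<and> K = K'" using KK by simp
  qed
  define q where "q = {(x, K) \<in> p. x \<in> N'}"
  have fin: "finite p" using p(1) by blast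
  have q: "q \<subseteq> p" "finite q" using fin finite_subset[of q p] by (auto simp: q_def)
  define E where "E = ?ends ` q"
  have E: "finite E" "\<And>u v. (u, v) \<in> E \<Longrightarrow> a \<le> u \<and> u \<le> v \<and> v \<le> b"
    using q pI by (fastforce simp: E_def)+
  have Edj: "pairwise (\<lambda>(u, v) (u', v'). disjnt {u<..<v} {u'<..<v'}) E"
    unfolding pairwise_def E_def using disj q(1) by (fastforce simp: disjnt_def)
  have "{u..v} \<subseteq> U" if uv: "(u, v) \<in> E" for u v
  proof -
    obtain x K where "(x, K) \<in> p" "x \<in> N'" "u = Inf K" "v = Sup K"
      using uv by (auto simp: E_def q_def)
    then show ?thesis using pI[of x K] by (auto simp: g_def)
  qed
  then have "(\<Sum>(u, v)\<in>E. v - u) \<le> measure lebesgue U"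
    using E U by (intro sum_lengths_le_measure Edj) auto
  then have len: "(\<Sum>(u, v)\<in>E. v - u) < \<eta>" using U by simp
  have osc: "(\<Sum>(u, v)\<in>E. norm (f v - f u)) < e"
    using \<delta>(2)[OF E(1) _ Edj] E len \<eta> by auto
  define r where "r K = f (Sup K) - f (Inf K) - (B + e) * (Sup K - Inf K)" for K
  have sumE: "(\<Sum>(x, K)\<in>q. h (Inf K) (Sup K)) = (\<Sum>(u, v)\<in>E. h u v)" for h :: "real \<Rightarrow> real \<Rightarrow> real"
    unfolding E_def using sum.reindex[OF inj_on_subset[OF inj q(1)], of "\<lambda>(u, v). h u v"]
    by (simp add: case_prod_unfold comp_def)
  have "f b - f a - (B + e) * (b - a) = (\<Sum>(x, K)\<in>p. r K)"
    using additive_tagged_division_1[OF ab p(1), of "\<lambda>t. f t - (B + e) * t"]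
    by (simp add: r_def algebra_simps)
  also have "\<dots> = (\<Sum>(x, K)\<in>q. r K) + (\<Sum>(x, K)\<in>p - q. r K)"
    by (metis add.commute fin q(1) sum.subset_diff)
  also have "(\<Sum>(x, K)\<in>p - q. r K) \<le> 0"
  proof (rule sum_nonpos, clarify)
    fix x K assume A: "(x, K) \<in> p" "(x, K) \<notin> q"
    then have x: "x \<in> {a..b} - N'" using pI[OF A(1)] by (auto simp: q_def)
    then have "K \<subseteq> ball x (d x)" using pI[OF A(1)] by (auto simp: g_def)
    then show "r K \<le> 0"
      using d(2)[OF x, of "Inf K" "Sup K"] pI[OF A(1)] unfolding r_def
      by (metis atLeastAtMost_iff diff_le_0_iff_le order.trans order_refl subsetD)
  qed
  also have "(\<Sum>(x, K)\<in>q. r K) \<le> (\<Sum>(x, K)\<in>q. norm (f (Sup K) - f (Inf K)) + \<bar>B + e\<bar> * (Sup K - Inf K))"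
  proof (rule sum_mono, clarify)
    fix x K assume A: "(x, K) \<in> q"
    have "- ((B + e) * (Sup K - Inf K)) \<le> \<bar>B + e\<bar> * (Sup K - Inf K)"
      using pI[of x K] A q(1)
      by (metis abs_ge_minus_self diff_ge_0_iff_ge minus_mult_left mult_right_mono order.trans subsetD)
    then show "r K \<le> norm (f (Sup K) - f (Inf K)) + \<bar>B + e\<bar> * (Sup K - Inf K)"
      by (auto simp: r_def)
  qed
  also have "\<dots> = (\<Sum>(u, v)\<in>E. norm (f v - f u)) + \<bar>B + e\<bar> * (\<Sum>(u, v)\<in>E. v - u)"
    using sumE[of "\<lambda>u v. norm (f v - f u) + \<bar>B + e\<bar> * (v - u)"]
    by (simp add: sum.distrib sum_distrib_left case_prod_unfold)
  also have "\<dots> \<le> e + \<bar>B + e\<bar> * \<eta>"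
    using osc len by (intro add_mono mult_left_mono) auto
  finally have "f b - f a \<le> (B + e) * (b - a) + 2 * e" using \<eta>(3) by simp
  also have "\<dots> = B * (b - a) + e * (b - a + 2)" by (simp add: algebra_simps)
  also have "e * (b - a + 2) = \<epsilon>" using ab by (simp add: e_def)
  finally show "f b - f a \<le> B * (b - a) + \<epsilon>" .
qed

section \<open>Operations on absolutely continuous functions\<close>

lemma abs_continuous_on_subinterval:
  assumes "abs_continuous_on a b f" "a \<le> a'" "b' \<le> b"
  shows "abs_continuous_on a' b' f"
  unfolding abs_continuous_on_def
proof (intro allI impI)
  fix \<epsilon> :: real assume "\<epsilon> > 0"
  then obtain \<delta> where "\<delta> > 0" and \<delta>: "\<And>D. finite D \<and> (\<forall>(u, v)\<in>D. a \<le> u \<and> u \<le> v \<and> v \<le> b) \<and>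
        pairwise (\<lambda>(u, v) (u', v'). disjnt {u<..<v} {u'<..<v'}) D \<and>
        (\<Sum>(u, v)\<in>D. v - u) < \<delta> \<Longrightarrow> (\<Sum>(u, v)\<in>D. norm (f v - f u)) < \<epsilon>"
    using assms(1) unfolding abs_continuous_on_def by blast
  then show "\<exists>\<delta>>0. \<forall>D. finite D \<and> (\<forall>(u, v)\<in>D. a' \<le> u \<and> u \<le> v \<and> v \<le> b') \<and>
        pairwise (\<lambda>(u, v) (u', v'). disjnt {u<..<v} {u'<..<v'}) D \<and>
        (\<Sum>(u, v)\<in>D. v - u) < \<delta> \<longrightarrow> (\<Sum>(u, v)\<in>D. norm (f v - f u)) < \<epsilon>"
    using assms(2,3) by (intro exI[of _ \<delta>] conjI allI impI \<delta>) fastforce+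
qed

text \<open>
  Squares of distances and embeddings into a product inherit absolute continuity this way: on a
  compact interval they oscillate at most a constant times as much as \<open>f\<close>.
\<close>

lemma abs_continuous_on_dominated:
  assumes "abs_continuous_on a b f" "C \<ge> 0"
    and le: "\<And>u v. a \<le> u \<Longrightarrow> u \<le> v \<Longrightarrow> v \<le> b \<Longrightarrow> norm (h v - h u) \<le> C * norm (f v - f u)"
  shows "abs_continuous_on a b h"
  unfolding abs_continuous_on_def
proof (intro allI impI)
  fix \<epsilon> :: real assume "\<epsilon> > 0"
  then have "\<epsilon> / (C + 1) > 0" using assms(2) by simp
  then obtain \<delta> where "\<delta> > 0" and \<delta>: "\<And>D. finite D \<and> (\<forall>(u, v)\<in>D. a \<le> u \<and> u \<le> v \<and> v \<le> b) \<and>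
        pairwise (\<lambda>(u, v) (u', v'). disjnt {u<..<v} {u'<..<v'}) D \<and>
        (\<Sum>(u, v)\<in>D. v - u) < \<delta> \<Longrightarrow> (\<Sum>(u, v)\<in>D. norm (f v - f u)) < \<epsilon> / (C + 1)"
    using assms(1) unfolding abs_continuous_on_def by blast
  show "\<exists>\<delta>>0. \<forall>D. finite D \<and> (\<forall>(u, v)\<in>D. a \<le> u \<and> u \<le> v \<and> v \<le> b) \<and>
        pairwise (\<lambda>(u, v) (u', v'). disjnt {u<..<v} {u'<..<v'}) D \<and>
        (\<Sum>(u, v)\<in>D. v - u) < \<delta> \<longrightarrow> (\<Sum>(u, v)\<in>D. norm (h v - h u)) < \<epsilon>"
  proof (intro exI[of _ \<delta>] conjI allI impI)
    fix D assume D: "finite D \<and> (\<forall>(u, v)\<in>D. a \<le> u \<and> u \<le> v \<and> v \<le> b) \<and>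
        pairwise (\<lambda>(u, v) (u', v'). disjnt {u<..<v} {u'<..<v'}) D \<and> (\<Sum>(u, v)\<in>D. v - u) < \<delta>"
    have "(\<Sum>(u, v)\<in>D. norm (h v - h u)) \<le> (\<Sum>(u, v)\<in>D. C * norm (f v - f u))"
      using D le by (intro sum_mono) auto
    also have "\<dots> = C * (\<Sum>(u, v)\<in>D. norm (f v - f u))"
      by (simp add: sum_distrib_left case_prod_unfold)
    also have "\<dots> \<le> C * (\<epsilon> / (C + 1))"
      using \<delta>[OF D] assms(2) by (intro mult_left_mono) auto
    also have "\<dots> < \<epsilon>" using \<open>\<epsilon> > 0\<close> assms(2) by (simp add: field_simps)
    finally show "(\<Sum>(u, v)\<in>D. norm (h v - h u)) < \<epsilon>" .
  qed (fact \<open>\<delta> > 0\<close>)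
qed

lemma abs_continuous_on_add:
  assumes "abs_continuous_on a b f" "abs_continuous_on a b g"
  shows "abs_continuous_on a b (\<lambda>t. f t + g t)"
  unfolding abs_continuous_on_def
proof (intro allI impI)
  fix \<epsilon> :: real assume "\<epsilon> > 0"
  then have "\<epsilon> / 2 > 0" by simp
  obtain \<delta>1 where "\<delta>1 > 0" and \<delta>1: "\<And>D. finite D \<and> (\<forall>(u, v)\<in>D. a \<le> u \<and> u \<le> v \<and> v \<le> b) \<and>
        pairwise (\<lambda>(u, v) (u', v'). disjnt {u<..<v} {u'<..<v'}) D \<and>
        (\<Sum>(u, v)\<in>D. v - u) < \<delta>1 \<Longrightarrow> (\<Sum>(u, v)\<in>D. norm (f v - f u)) < \<epsilon> / 2"
    using assms(1) \<open>\<epsilon> / 2 > 0\<close> unfolding abs_continuous_on_def by blast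
  obtain \<delta>2 where "\<delta>2 > 0" and \<delta>2: "\<And>D. finite D \<and> (\<forall>(u, v)\<in>D. a \<le> u \<and> u \<le> v \<and> v \<le> b) \<and>
        pairwise (\<lambda>(u, v) (u', v'). disjnt {u<..<v} {u'<..<v'}) D \<and>
        (\<Sum>(u, v)\<in>D. v - u) < \<delta>2 \<Longrightarrow> (\<Sum>(u, v)\<in>D. norm (g v - g u)) < \<epsilon> / 2"
    using assms(2) \<open>\<epsilon> / 2 > 0\<close> unfolding abs_continuous_on_def by blast
  show "\<exists>\<delta>>0. \<forall>D. finite D \<and> (\<forall>(u, v)\<in>D. a \<le> u \<and> u \<le> v \<and> v \<le> b) \<and>
        pairwise (\<lambda>(u, v) (u', v'). disjnt {u<..<v} {u'<..<v'}) D \<and>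
        (\<Sum>(u, v)\<in>D. v - u) < \<delta> \<longrightarrow> (\<Sum>(u, v)\<in>D. norm (f v + g v - (f u + g u))) < \<epsilon>"
  proof (intro exI[of _ "min \<delta>1 \<delta>2"] conjI allI impI)
    fix D assume D: "finite D \<and> (\<forall>(u, v)\<in>D. a \<le> u \<and> u \<le> v \<and> v \<le> b) \<and>
        pairwise (\<lambda>(u, v) (u', v'). disjnt {u<..<v} {u'<..<v'}) D \<and>
        (\<Sum>(u, v)\<in>D. v - u) < min \<delta>1 \<delta>2"
    have "(\<Sum>(u, v)\<in>D. norm (f v + g v - (f u + g u)))
        \<le> (\<Sum>(u, v)\<in>D. norm (f v - f u) + norm (g v - g u))"
      by (intro sum_mono) (auto simp: add_diff_add norm_triangle_ineq)
    also have "\<dots> = (\<Sum>(u, v)\<in>D. norm (f v - f u)) + (\<Sum>(u, v)\<in>D. norm (g v - g u))"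
      by (simp add: sum.distrib case_prod_unfold)
    also have "\<dots> < \<epsilon>" using \<delta>1[of D] \<delta>2[of D] D by auto
    finally show "(\<Sum>(u, v)\<in>D. norm (f v + g v - (f u + g u))) < \<epsilon>" .
  qed (use \<open>\<delta>1 > 0\<close> \<open>\<delta>2 > 0\<close> in auto)
qed

lemma abs_continuous_on_const: "abs_continuous_on a b (\<lambda>t. k)"
  unfolding abs_continuous_on_def by (auto intro!: exI[of _ 1])

lemma abs_continuous_on_sum:
  assumes "\<And>j. j \<in> J \<Longrightarrow> abs_continuous_on a b (f j)"
  shows "abs_continuous_on a b (\<lambda>t. \<Sum>j\<in>J. f j t)"
  using assms
  by (induction J rule: infinite_finite_induct)
     (auto intro: abs_continuous_on_const abs_continuous_on_add)

lemma abs_continuous_on_imp_continuous_on: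
  assumes "abs_continuous_on a b f"
  shows "continuous_on {a..b} f"
  unfolding continuous_on_iff
proof (intro ballI allI impI)
  fix t \<epsilon> :: real assume t: "t \<in> {a..b}" and "\<epsilon> > 0"
  then obtain \<delta> where "\<delta> > 0" and \<delta>: "\<And>D. finite D \<and> (\<forall>(u, v)\<in>D. a \<le> u \<and> u \<le> v \<and> v \<le> b) \<and>
        pairwise (\<lambda>(u, v) (u', v'). disjnt {u<..<v} {u'<..<v'}) D \<and>
        (\<Sum>(u, v)\<in>D. v - u) < \<delta> \<Longrightarrow> (\<Sum>(u, v)\<in>D. norm (f v - f u)) < \<epsilon>"
    using assms(1) unfolding abs_continuous_on_def by blast
  show "\<exists>d>0. \<forall>s\<in>{a..b}. dist s t < d \<longrightarrow> dist (f s) (f t) < \<epsilon>"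
  proof (intro exI[of _ \<delta>] conjI ballI impI)
    fix s assume s: "s \<in> {a..b}" "dist s t < \<delta>"
    show "dist (f s) (f t) < \<epsilon>"
      using \<delta>[of "{(min s t, max s t)}"] s t
      by (cases "s \<le> t") (auto simp: dist_real_def dist_norm norm_minus_commute min_def max_def)
  qed (fact \<open>\<delta> > 0\<close>)
qed

lemma abs_continuous_on_norm_square:
  fixes f :: "real \<Rightarrow> 'a::real_normed_vector"
  assumes ac: "abs_continuous_on a b f"
  shows "abs_continuous_on a b (\<lambda>t. (norm (f t - z))\<^sup>2)"
proof -
  have "continuous_on {a..b} (\<lambda>t. f t - z)"
    using abs_continuous_on_imp_continuous_on[OF ac] by (intro continuous_intros)
  then have "bounded ((\<lambda>t. f t - z) ` {a..b})"
    by (intro compact_imp_bounded compact_continuous_image) auto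
  then obtain M where M: "M > 0" "\<And>t. t \<in> {a..b} \<Longrightarrow> norm (f t - z) \<le> M"
    unfolding bounded_pos by auto
  show ?thesis
  proof (rule abs_continuous_on_dominated[OF ac])
    show "0 \<le> 2 * M" using M(1) by simp
    fix u v assume uv: "a \<le> u" "u \<le> v" "v \<le> b"
    have "norm ((norm (f v - z))\<^sup>2 - (norm (f u - z))\<^sup>2)
       = \<bar>norm (f v - z) + norm (f u - z)\<bar> * \<bar>norm (f v - z) - norm (f u - z)\<bar>"
      by (simp add: power2_eq_square square_diff_square_factored abs_mult)
    also have "\<dots> \<le> (2 * M) * norm (f v - f u)"
    proof (rule mult_mono)
      show "\<bar>norm (f v - z) + norm (f u - z)\<bar> \<le> 2 * M"
        using M(2)[of u] M(2)[of v] uv by simp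
      show "\<bar>norm (f v - z) - norm (f u - z)\<bar> \<le> norm (f v - f u)"
        using norm_triangle_ineq3[of "f v - z" "f u - z"] by simp
    qed (use M(1) in auto)
    finally show "norm ((norm (f v - z))\<^sup>2 - (norm (f u - z))\<^sup>2) \<le> 2 * M * norm (f v - f u)" .
  qed
qed

lemma abs_continuous_on_Pair:
  assumes "abs_continuous_on a b x" "abs_continuous_on a b y"
  shows "abs_continuous_on a b (\<lambda>t. (x t, y t))"
proof -
  have "abs_continuous_on a b (\<lambda>t. (x t, 0::'b))"
    by (rule abs_continuous_on_dominated[OF assms(1), of 1]) (auto simp: norm_Pair)
  moreover have "abs_continuous_on a b (\<lambda>t. (0::'a, y t))"
    by (rule abs_continuous_on_dominated[OF assms(2), of 1]) (auto simp: norm_Pair)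
  ultimately show ?thesis using abs_continuous_on_add by fastforce
qed


section \<open>Sign preservation and dissipation along absolutely continuous trajectories\<close>

text \<open>
  If \<open>f\<close> were negative at \<open>b\<close>, then after the last time \<open>s\<close> at which it is nonnegative its
  derivative would be nonnegative almost everywhere, so it could not have decreased.
\<close>

lemma abs_continuous_nonneg:
  fixes f :: "real \<Rightarrow> real"
  assumes ac: "abs_continuous_on a b f" and ab: "a \<le> b" and "f a \<ge> 0"
    and ae: "AE t in lebesgue. t > a \<longrightarrow> f t \<le> 0 \<longrightarrow> (\<exists>D\<ge>0. (f has_real_derivative D) (at t))"
  shows "f b \<ge> 0"
proof (rule ccontr)
  assume "\<not> f b \<ge> 0"
  define S where "S = {a..b} \<inter> f -` {0..}"
  have "closed S"
    unfolding S_def using abs_continuous_on_imp_continuous_on[OF ac]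
    by (intro continuous_closed_preimage) auto
  have S: "a \<in> S" "bdd_above S" using \<open>f a \<ge> 0\<close> ab by (auto simp: S_def intro: bdd_aboveI)
  define s where "s = Sup S"
  have "s \<in> S" unfolding s_def using S \<open>closed S\<close> by (intro closed_contains_Sup) auto
  then have s: "a \<le> s" "s \<le> b" "f s \<ge> 0" by (auto simp: S_def)
  have neg: "f t < 0" if "t \<in> {s<..<b}" for t
  proof (rule ccontr)
    assume "\<not> f t < 0"
    then have "t \<in> S" using that s by (auto simp: S_def)
    then show False using cSup_upper[OF _ S(2)] that by (force simp: s_def)
  qed
  have "- f b - (- f s) \<le> 0 * (b - s)"
  proof (rule abs_continuous_increment_le[OF s(2)])
    show "abs_continuous_on s b (\<lambda>t. - f t)"
      by (rule abs_continuous_on_dominated[of _ _ f 1])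
         (use abs_continuous_on_subinterval[OF ac s(1) order_refl] in
           \<open>auto simp: norm_minus_commute\<close>)
    show "AE t in lebesgue. t \<in> {s<..<b} \<longrightarrow> (\<exists>D\<le>0. ((\<lambda>t. - f t) has_real_derivative D) (at t))"
      using ae
    proof (eventually_elim, intro impI)
      fix t assume H: "t > a \<longrightarrow> f t \<le> 0 \<longrightarrow> (\<exists>D\<ge>0. (f has_real_derivative D) (at t))"
        and t: "t \<in> {s<..<b}"
      then obtain D where "D \<ge> 0" "(f has_real_derivative D) (at t)"
        using neg[OF t] s(1) by auto
      then show "\<exists>D\<le>0. ((\<lambda>t. - f t) has_real_derivative D) (at t)"
        by (intro exI[of _ "- D"]) (auto intro: DERIV_minus)
    qed
  qed
  then show False using s(3) \<open>\<not> f b \<ge> 0\<close> by simp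
qed

text \<open>
  A Barbalat argument without integrals. The derivative bound \<open>K\<close> keeps \<open>\<phi>\<close> above \<open>\<epsilon> / 2\<close>
  for the duration \<open>h\<close> after any time at which \<open>\<phi> \<ge> \<epsilon>\<close>, which costs \<open>V\<close> at least
  \<open>c (\<epsilon> / 2) h\<close>. As \<open>V\<close> decreases and is bounded below, it cannot pay this once it is
  closer than that to its infimum.
\<close>

lemma dissipated_quantity_tendsto_0:
  fixes V \<phi> :: "real \<Rightarrow> real"
  assumes acV: "\<And>T. T > 0 \<Longrightarrow> abs_continuous_on 0 T V"
    and ac\<phi>: "\<And>T. T > 0 \<Longrightarrow> abs_continuous_on 0 T \<phi>"
    and V': "AE t in lebesgue. t > 0 \<longrightarrow> (\<exists>D\<le>- c * \<phi> t. (V has_real_derivative D) (at t))"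
    and \<phi>': "AE t in lebesgue. t > 0 \<longrightarrow> (\<exists>D. \<bar>D\<bar> \<le> K \<and> (\<phi> has_real_derivative D) (at t))"
    and c: "c > 0" and K: "K > 0"
    and V0: "\<And>t. t \<ge> 0 \<Longrightarrow> V t \<ge> 0" and \<phi>0: "\<And>t. t \<ge> 0 \<Longrightarrow> \<phi> t \<ge> 0"
  shows "(\<phi> \<longlongrightarrow> 0) at_top"
proof (rule tendstoI)
  fix \<epsilon> :: real assume "\<epsilon> > 0"
  \<comment> \<open>The time \<open>\<phi>\<close> needs to fall from \<open>\<epsilon>\<close> to \<open>\<epsilon> / 2\<close> at rate \<open>K\<close>.\<close>
  define h where "h = \<epsilon> / (2 * K)"
  have h: "h > 0" using \<open>\<epsilon> > 0\<close> K by (simp add: h_def)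
  have acV': "abs_continuous_on s t V" if "0 \<le> s" "s \<le> t" for s t
    using that abs_continuous_on_subinterval[OF acV[of "t + 1"]] by auto
  have \<phi>_drop: "\<phi> s - \<phi> t \<le> K * (t - s)" if st: "0 \<le> s" "s \<le> t" for s t
  proof -
    have "- \<phi> t - (- \<phi> s) \<le> K * (t - s)"
    proof (rule abs_continuous_increment_le[OF st(2)])
      have "abs_continuous_on s t \<phi>"
        using st abs_continuous_on_subinterval[OF ac\<phi>[of "t + 1"]] by auto
      then show "abs_continuous_on s t (\<lambda>t. - \<phi> t)"
        by (rule abs_continuous_on_dominated[of _ _ _ 1]) (auto simp: norm_minus_commute)
      show "AE r in lebesgue. r \<in> {s<..<t} \<longrightarrow> (\<exists>D\<le>K. ((\<lambda>t. - \<phi> t) has_real_derivative D) (at r))"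
        using \<phi>'
      proof (eventually_elim, intro impI)
        fix r assume "r > 0 \<longrightarrow> (\<exists>D. \<bar>D\<bar> \<le> K \<and> (\<phi> has_real_derivative D) (at r))" "r \<in> {s<..<t}"
        then obtain D where "\<bar>D\<bar> \<le> K" "(\<phi> has_real_derivative D) (at r)" using st by auto
        then show "\<exists>D\<le>K. ((\<lambda>t. - \<phi> t) has_real_derivative D) (at r)"
          by (intro exI[of _ "- D"]) (auto intro: DERIV_minus)
      qed
    qed
    then show ?thesis by simp
  qed
  have V_inc: "V t - V s \<le> B * (t - s)"
    if st: "0 \<le> s" "s \<le> t" and B: "\<And>r. r \<in> {s<..<t} \<Longrightarrow> - c * \<phi> r \<le> B" for s t B
  proof (rule abs_continuous_increment_le[OF st(2) acV'[OF st]])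
    show "AE r in lebesgue. r \<in> {s<..<t} \<longrightarrow> (\<exists>D\<le>B. (V has_real_derivative D) (at r))"
      using V'
    proof (eventually_elim, intro impI)
      fix r assume "r > 0 \<longrightarrow> (\<exists>D\<le>- c * \<phi> r. (V has_real_derivative D) (at r))" "r \<in> {s<..<t}"
      then show "\<exists>D\<le>B. (V has_real_derivative D) (at r)"
        using st(1) B[of r] by (auto intro: order.trans)
    qed
  qed
  have V_anti: "V t \<le> V s" if "0 \<le> s" "s \<le> t" for s t
    using V_inc[OF that, of 0] \<phi>0 c that by auto
  have V_drop: "V (t + h) \<le> V t - c * (\<epsilon> / 2) * h" if t: "t \<ge> 0" "\<phi> t \<ge> \<epsilon>" for t
  proof -
    have "- c * \<phi> r \<le> - c * (\<epsilon> / 2)" if r: "r \<in> {t<..<t + h}" for r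
    proof -
      have "K * (r - t) \<le> K * h" using r K by (intro mult_left_mono) auto
      then have "\<phi> t - \<phi> r \<le> \<epsilon> / 2" using \<phi>_drop[of t r] r t(1) K by (simp add: h_def)
      then show ?thesis using t(2) c by simp
    qed
    then have "V (t + h) - V t \<le> - c * (\<epsilon> / 2) * (t + h - t)"
      using t(1) h by (intro V_inc) auto
    then show ?thesis by simp
  qed
  define L where "L = Inf (V ` {0..})"
  have bdd: "bdd_below (V ` {0..})" using V0 by (auto intro!: bdd_belowI[of _ 0])
  have L_le: "L \<le> V t" if "t \<ge> 0" for t
    unfolding L_def using bdd that by (intro cInf_lower) auto
  have "c * (\<epsilon> / 2) * h > 0" using c h \<open>\<epsilon> > 0\<close> by simp
  then have "\<exists>v\<in>V ` {0..}. v < L + c * (\<epsilon> / 2) * h"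
    unfolding L_def using bdd by (subst cInf_less_iff[symmetric]) auto
  then obtain T where T: "T \<ge> 0" "V T < L + c * (\<epsilon> / 2) * h" by auto
  have "dist (\<phi> t) 0 < \<epsilon>" if "t \<ge> T" for t
  proof (rule ccontr)
    assume "\<not> dist (\<phi> t) 0 < \<epsilon>"
    then have "\<phi> t \<ge> \<epsilon>" using \<phi>0[of t] that T by auto
    then have "V (t + h) \<le> V t - c * (\<epsilon> / 2) * h" using V_drop that T by auto
    then show False using L_le[of "t + h"] V_anti[of T t] that T h by auto
  qed
  then show "\<forall>\<^sub>F t in at_top. dist (\<phi> t) 0 < \<epsilon>"
    by (auto simp: eventually_at_top_linorder)
qed

section \<open>Lagrange multipliers\<close>

text \<open>
  The constraint qualification \<open>cq\<close> asks that a direction \<open>d\<close> along which no active constraint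
  increases to first order stays feasible for a short time. If \<open>- D\<close> were outside the cone
  generated by the gradients of the active constraints, the normal of a
  separating hyperplane would be such a direction and a descent direction of \<open>f\<close>, against minimality. The cone is closed because it is
  finitely generated.
\<close>

lemma karush_kuhn_tucker:
  fixes f :: "'a::euclidean_space \<Rightarrow> real" and g :: "'j \<Rightarrow> 'a \<Rightarrow> real"
  assumes J: "finite J" and Df: "GDERIV f x :> D"
    and feas: "\<And>j. j \<in> J \<Longrightarrow> g j x \<le> 0"
    and min: "\<And>y. (\<And>j. j \<in> J \<Longrightarrow> g j y \<le> 0) \<Longrightarrow> f x \<le> f y"
    and cq: "\<And>j d. j \<in> J \<Longrightarrow> (g j x = 0 \<Longrightarrow> d \<bullet> G j \<le> 0) \<Longrightarrow>
               \<forall>\<^sub>F t in at_right 0. g j (x + t *\<^sub>R d) \<le> 0"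
  shows "\<exists>\<mu>. (\<forall>j\<in>J. \<mu> j \<ge> 0 \<and> \<mu> j * g j x = 0) \<and> D + (\<Sum>j\<in>J. \<mu> j *\<^sub>R G j) = 0"
proof -
  define A where "A = {j \<in> J. g j x = 0}"
  have A: "finite A" "A \<subseteq> J" using J by (auto simp: A_def)
  define K where "K = convex_cone hull (G ` A)"
  have "- D \<in> K"
  proof (rule ccontr)
    assume notin: "- D \<notin> K"
    have "convex K" "closed K"
      using A by (auto simp: K_def convex_convex_cone_hull closed_convex_cone_hull)
    from separating_hyperplane_closed_point[OF this notin]
    obtain a b where ab: "a \<bullet> (- D) < b" "\<And>k. k \<in> K \<Longrightarrow> a \<bullet> k > b" by auto
    have "b < 0" using ab(2)[of 0] by (simp add: K_def convex_cone_hull_contains_0)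
    \<comment> \<open>On a cone, a linear functional that is bounded below is nonnegative: otherwise the scaling that
      brings its value down to \<open>b\<close> contradicts the separation.\<close>
    have nonneg: "a \<bullet> k \<ge> 0" if "k \<in> K" for k
    proof (rule ccontr)
      assume neg: "\<not> a \<bullet> k \<ge> 0"
      then have "b / (a \<bullet> k) \<ge> 0" using \<open>b < 0\<close> by (simp add: divide_nonpos_nonpos)
      then have "(b / (a \<bullet> k)) *\<^sub>R k \<in> K" using that by (simp add: K_def convex_cone_hull_mul)
      then show False using ab(2)[of "(b / (a \<bullet> k)) *\<^sub>R k"] neg by simp
    qed
    define d where "d = - a"
    have dG: "d \<bullet> G j \<le> 0" if "j \<in> A" for j
      using nonneg[of "G j"] that by (simp add: K_def d_def hull_inc)
    have dD: "d \<bullet> D < 0" using ab(1) \<open>b < 0\<close> by (simp add: d_def)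
    have "\<forall>\<^sub>F t in at_right 0. \<forall>j\<in>J. g j (x + t *\<^sub>R d) \<le> 0"
      using J dG by (intro eventually_ball_finite ballI cq) (auto simp: A_def)
    then have ge: "\<forall>\<^sub>F t in at_right 0. f x \<le> f (x + t *\<^sub>R d)"
      by eventually_elim (rule min, blast)
    have "((\<lambda>t. f (x + t *\<^sub>R d)) has_real_derivative d \<bullet> D) (at 0)"
    proof -
      have "((\<lambda>t. x + t *\<^sub>R d) has_derivative (\<lambda>t. t *\<^sub>R d)) (at (0::real))"
        by (auto intro!: derivative_eq_intros)
      moreover have "(f has_derivative (\<lambda>h. h \<bullet> D)) (at (x + 0 *\<^sub>R d))"
        using Df by (simp add: gderiv_def)
      ultimately have "((\<lambda>t. f (x + t *\<^sub>R d)) has_derivative (\<lambda>t. (t *\<^sub>R d) \<bullet> D)) (at (0::real))"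
        by (rule has_derivative_compose)
      then show ?thesis by (simp add: has_field_derivative_def mult_commute_abs)
    qed
    then obtain r where r: "r > 0" "\<And>h. 0 < h \<Longrightarrow> h < r \<Longrightarrow> f (x + (0 + h) *\<^sub>R d) < f (x + 0 *\<^sub>R d)"
      using DERIV_neg_dec_right[OF _ dD] by blast
    then have "\<forall>\<^sub>F t in at_right 0. f (x + t *\<^sub>R d) < f x"
      by (auto simp: eventually_at_right_field)
    with ge have "\<forall>\<^sub>F t in at_right (0::real). False"
      by eventually_elim simp
    then show False by simp
  qed
  \<comment> \<open>The hull is contained in the set of explicit nonnegative combinations, which is itself a
    convex cone.\<close>
  moreover have "K \<subseteq> {\<Sum>j\<in>A. \<mu> j *\<^sub>R G j | \<mu>. \<forall>j\<in>A. \<mu> j \<ge> 0}" (is "_ \<subseteq> ?C")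
    unfolding K_def
  proof (rule hull_minimal)
    show "G ` A \<subseteq> ?C"
    proof clarify
      fix j assume j: "j \<in> A"
      have "(\<Sum>i\<in>A. (if i = j then 1 else 0) *\<^sub>R G i) = G j"
        using A(1) j by (simp add: if_distrib[of "\<lambda>c. c *\<^sub>R _"] sum.delta cong: if_cong)
      then show "\<exists>\<mu>. G j = (\<Sum>i\<in>A. \<mu> i *\<^sub>R G i) \<and> (\<forall>i\<in>A. \<mu> i \<ge> 0)"
        by (intro exI[of _ "\<lambda>i. if i = j then 1 else 0"]) auto
    qed
    show "convex_cone ?C"
      unfolding convex_cone_iff
    proof (intro conjI ballI allI impI)
      show "0 \<in> ?C" by (auto intro!: exI[of _ "\<lambda>_. 0"])
    next
      fix y z assume "y \<in> ?C" "z \<in> ?C"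
      then obtain \<mu> \<nu> where "\<forall>j\<in>A. \<mu> j \<ge> 0" "\<forall>j\<in>A. \<nu> j \<ge> 0"
        "y = (\<Sum>j\<in>A. \<mu> j *\<^sub>R G j)" "z = (\<Sum>j\<in>A. \<nu> j *\<^sub>R G j)" by auto
      then show "y + z \<in> ?C"
        by (auto intro!: exI[of _ "\<lambda>j. \<mu> j + \<nu> j"] simp: scaleR_left_distrib sum.distrib)
    next
      fix y and c :: real assume "y \<in> ?C" "0 \<le> c"
      then obtain \<mu> where "\<forall>j\<in>A. \<mu> j \<ge> 0" "y = (\<Sum>j\<in>A. \<mu> j *\<^sub>R G j)" by auto
      then show "c *\<^sub>R y \<in> ?C"
        using \<open>0 \<le> c\<close> by (auto intro!: exI[of _ "\<lambda>j. c * \<mu> j"] simp: scaleR_sum_right)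
    qed
  qed
  ultimately obtain \<mu> where \<mu>: "\<forall>j\<in>A. \<mu> j \<ge> 0" "- D = (\<Sum>j\<in>A. \<mu> j *\<^sub>R G j)" by auto
  have "(\<Sum>j\<in>J. (if j \<in> A then \<mu> j else 0) *\<^sub>R G j) = (\<Sum>j\<in>A. \<mu> j *\<^sub>R G j)"
    using J A by (intro sum.mono_neutral_cong_right) auto
  then have "D + (\<Sum>j\<in>J. (if j \<in> A then \<mu> j else 0) *\<^sub>R G j) = 0"
    using \<mu>(2)[symmetric] by simp
  then show ?thesis
    using \<mu>(1) by (intro exI[of _ "\<lambda>j. if j \<in> A then \<mu> j else 0"]) (auto simp: A_def)
qed

section \<open>Saddle point dynamics of strongly convex programs\<close>

lemma pos_proj_nonneg: "y \<le> 0 \<Longrightarrow> pos_proj x y \<ge> 0"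
  by (simp add: pos_proj_def)

text \<open>
  The projection acts only when \<open>y = 0\<close>, where it raises the velocity; the factor \<open>y - z\<close> is then
  nonpositive. So projecting never moves a multiplier \<open>y\<close> away from a nonnegative \<open>z\<close>
  faster than the unprojected velocity would.
\<close>

lemma pos_proj_mult_le:
  assumes "y \<ge> 0" "z \<ge> 0"
  shows "(y - z) * pos_proj x y \<le> (y - z) * x"
  using assms by (auto simp: pos_proj_def max_def mult_nonneg_nonpos)

lemma has_real_derivative_norm_square:
  fixes x :: "real \<Rightarrow> 'a::real_inner"
  assumes "(x has_vector_derivative v) (at t)"
  shows "((\<lambda>s. (norm (x s - z))\<^sup>2) has_real_derivative 2 * ((x t - z) \<bullet> v)) (at t)"
proof -
  have "(x has_derivative (\<lambda>h. h *\<^sub>R v)) (at t)"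
    using assms by (simp add: has_vector_derivative_def)
  then have "((\<lambda>s. (x s - z) \<bullet> (x s - z)) has_derivative (\<lambda>h. h * (2 * ((x t - z) \<bullet> v)))) (at t)"
    by (auto intro!: derivative_eq_intros simp: inner_commute)
  then show ?thesis
    by (simp add: has_field_derivative_def power2_norm_eq_inner mult_commute_abs)
qed

text \<open>
  The left-hand side is half the derivative of \<open>\<parallel>x - xs\<parallel>\<^sup>2 + \<Sum> (\<mu>\<^sub>j - \<mu>s\<^sub>j)\<^sup>2\<close> along the
  dynamics. Subtracting the stationarity condition leaves the monotone part of the
  objective and, for each constraint, terms that the two convexity inequalities between \<open>x\<close>
  and \<open>xs\<close>, weighted by \<open>\<mu>\<^sub>j\<close> and \<open>\<mu>s\<^sub>j\<close>, bound by \<open>\<mu>\<^sub>j g\<^sub>j(xs) \<le> 0\<close>.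
\<close>

lemma saddle_dissipation:
  fixes Df :: "'a::real_inner \<Rightarrow> 'a" and g :: "'j \<Rightarrow> 'a \<Rightarrow> real"
  assumes mono: "\<And>y z. (Df y - Df z) \<bullet> (y - z) \<ge> c * (norm (y - z))\<^sup>2"
    and conv: "\<And>j y z. j \<in> J \<Longrightarrow> g j z \<ge> g j y + G j y \<bullet> (z - y)"
    and kkt: "Df xs + (\<Sum>j\<in>J. \<mu>s j *\<^sub>R G j xs) = 0"
    and comp: "\<And>j. j \<in> J \<Longrightarrow> \<mu>s j \<ge> 0 \<and> g j xs \<le> 0 \<and> \<mu>s j * g j xs = 0"
    and \<mu>: "\<And>j. j \<in> J \<Longrightarrow> \<mu> j \<ge> 0"
  shows "(x - xs) \<bullet> (- (Df x + (\<Sum>j\<in>J. \<mu> j *\<^sub>R G j x))) +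
         (\<Sum>j\<in>J. (\<mu> j - \<mu>s j) * pos_proj (g j x) (\<mu> j)) \<le> - c * (norm (x - xs))\<^sup>2"
proof -
  have "(\<Sum>j\<in>J. \<mu>s j * (G j xs \<bullet> (x - xs)) - \<mu> j * (G j x \<bullet> (x - xs)) +
          (\<mu> j - \<mu>s j) * pos_proj (g j x) (\<mu> j)) \<le> 0"
  proof (rule sum_nonpos)
    fix j assume j: "j \<in> J"
    have "\<mu>s j * (G j xs \<bullet> (x - xs)) \<le> \<mu>s j * (g j x - g j xs)"
      using conv[OF j, of xs x] comp[OF j] by (intro mult_left_mono) auto
    moreover have "\<mu> j * (G j x \<bullet> (xs - x)) \<le> \<mu> j * (g j xs - g j x)"
      using conv[OF j, of x xs] \<mu>[OF j] by (intro mult_left_mono) auto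
    moreover have "G j x \<bullet> (xs - x) = - (G j x \<bullet> (x - xs))"
      by (simp add: inner_diff_right)
    moreover have "\<mu> j * g j xs \<le> 0"
      using \<mu>[OF j] comp[OF j] by (simp add: mult_nonneg_nonpos)
    moreover have "(\<mu> j - \<mu>s j) * pos_proj (g j x) (\<mu> j) \<le> (\<mu> j - \<mu>s j) * g j x"
      using pos_proj_mult_le \<mu>[OF j] comp[OF j] by auto
    moreover have "\<mu>s j * g j xs = 0" using comp[OF j] by simp
    ultimately show "\<mu>s j * (G j xs \<bullet> (x - xs)) - \<mu> j * (G j x \<bullet> (x - xs)) +
          (\<mu> j - \<mu>s j) * pos_proj (g j x) (\<mu> j) \<le> 0"
      by (simp add: algebra_simps)
  qed
  moreover have "Df xs \<bullet> (x - xs) + (\<Sum>j\<in>J. \<mu>s j * (G j xs \<bullet> (x - xs))) = 0"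
  proof -
    have "(Df xs + (\<Sum>j\<in>J. \<mu>s j *\<^sub>R G j xs)) \<bullet> (x - xs) = 0" using kkt by simp
    then show ?thesis by (simp add: inner_add_left inner_sum_left)
  qed
  moreover have "(x - xs) \<bullet> (- (Df x + (\<Sum>j\<in>J. \<mu> j *\<^sub>R G j x))) =
      - (Df x \<bullet> (x - xs)) - (\<Sum>j\<in>J. \<mu> j * (G j x \<bullet> (x - xs)))"
    by (simp only: inner_commute[of "x - xs"] inner_minus_left inner_add_left inner_sum_left
          inner_scaleR_left)
  moreover have "c * (norm (x - xs))\<^sup>2 \<le> Df x \<bullet> (x - xs) - Df xs \<bullet> (x - xs)"
    using mono[of x xs] by (simp add: inner_diff_left)
  ultimately show ?thesis
    by (simp add: sum.distrib sum_subtractf)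
qed

text \<open>
  The objective enters only through its strongly monotone gradient field \<open>Df\<close>. The
  nonincreasing distance to the saddle point controls both \<open>x\<close> and the multipliers, so the
  velocity is bounded along the trajectory, which supplies the Lipschitz bound that the dissipation argument needs.
\<close>

theorem saddle_dynamics_converge:
  fixes Df :: "'a::euclidean_space \<Rightarrow> 'a" and g :: "'j \<Rightarrow> 'a \<Rightarrow> real"
    and x :: "real \<Rightarrow> 'a" and \<mu> :: "real \<Rightarrow> 'j \<Rightarrow> real"
  assumes J: "finite J" and c: "c > 0"
    and mono: "\<And>y z. (Df y - Df z) \<bullet> (y - z) \<ge> c * (norm (y - z))\<^sup>2"
    and conv: "\<And>j y z. j \<in> J \<Longrightarrow> g j z \<ge> g j y + G j y \<bullet> (z - y)"
    and contDf: "continuous_on UNIV Df" and contG: "\<And>j. j \<in> J \<Longrightarrow> continuous_on UNIV (G j)"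
    and kkt: "Df xs + (\<Sum>j\<in>J. \<mu>s j *\<^sub>R G j xs) = 0"
    and comp: "\<And>j. j \<in> J \<Longrightarrow> \<mu>s j \<ge> 0 \<and> g j xs \<le> 0 \<and> \<mu>s j * g j xs = 0"
    and x: "caratheodory x (\<lambda>t. - (Df (x t) + (\<Sum>j\<in>J. \<mu> t j *\<^sub>R G j (x t))))"
    and \<mu>: "\<And>j. j \<in> J \<Longrightarrow> caratheodory (\<lambda>t. \<mu> t j) (\<lambda>t. pos_proj (g j (x t)) (\<mu> t j))"
    and \<mu>0: "\<And>j. j \<in> J \<Longrightarrow> \<mu> 0 j \<ge> 0"
  shows "(x \<longlongrightarrow> xs) at_top"
proof -
  let ?F = "\<lambda>t. - (Df (x t) + (\<Sum>j\<in>J. \<mu> t j *\<^sub>R G j (x t)))"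
  have acx: "abs_continuous_on 0 T x" if "T > 0" for T
    using x that by (simp add: caratheodory_def)
  have ac\<mu>: "abs_continuous_on 0 T (\<lambda>t. \<mu> t j)" if "j \<in> J" "T > 0" for j T
    using \<mu> that by (simp add: caratheodory_def)
  have x': "AE t in lebesgue. t > 0 \<longrightarrow> (x has_vector_derivative ?F t) (at t)"
    using x by (simp add: caratheodory_def)
  have \<mu>': "AE t in lebesgue. \<forall>j\<in>J. t > 0 \<longrightarrow>
      ((\<lambda>t. \<mu> t j) has_vector_derivative pos_proj (g j (x t)) (\<mu> t j)) (at t)"
    using J \<mu> by (intro eventually_ball_finite) (auto simp: caratheodory_def)
  have \<mu>_nonneg: "\<mu> t j \<ge> 0" if j: "j \<in> J" and t: "t \<ge> 0" for t j
  proof (cases "t = 0")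
    case False
    show ?thesis
    proof (rule abs_continuous_nonneg[OF _ t])
      show "abs_continuous_on 0 t (\<lambda>t. \<mu> t j)" using ac\<mu>[OF j] t False by simp
      show "AE t in lebesgue. t > 0 \<longrightarrow> \<mu> t j \<le> 0 \<longrightarrow>
          (\<exists>D\<ge>0. ((\<lambda>t. \<mu> t j) has_real_derivative D) (at t))"
        using \<mu>'
      proof (eventually_elim, intro impI)
        fix t assume "\<forall>j\<in>J. t > 0 \<longrightarrow>
            ((\<lambda>t. \<mu> t j) has_vector_derivative pos_proj (g j (x t)) (\<mu> t j)) (at t)"
          "t > 0" "\<mu> t j \<le> 0"
        then show "\<exists>D\<ge>0. ((\<lambda>t. \<mu> t j) has_real_derivative D) (at t)"
          using j pos_proj_nonneg by (auto simp: has_real_derivative_iff_has_vector_derivative)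
      qed
    qed (use \<mu>0 j in auto)
  qed (use \<mu>0 j in auto)
  define \<phi> where "\<phi> t = (norm (x t - xs))\<^sup>2" for t
  define V where "V t = \<phi> t + (\<Sum>j\<in>J. (norm (\<mu> t j - \<mu>s j))\<^sup>2)" for t
  have ac\<phi>: "abs_continuous_on 0 T \<phi>" if "T > 0" for T
    unfolding \<phi>_def using acx[OF that] by (rule abs_continuous_on_norm_square)
  have acV: "abs_continuous_on 0 T V" if "T > 0" for T
    unfolding V_def using that
    by (intro abs_continuous_on_add ac\<phi> abs_continuous_on_sum abs_continuous_on_norm_square ac\<mu>)
  have \<phi>_le_V: "\<phi> t \<le> V t" for t by (simp add: V_def sum_nonneg)
  have \<mu>_le_V: "(norm (\<mu> t j - \<mu>s j))\<^sup>2 \<le> V t" if "j \<in> J" for t j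
  proof -
    have "(norm (\<mu> t j - \<mu>s j))\<^sup>2 \<le> (\<Sum>j\<in>J. (norm (\<mu> t j - \<mu>s j))\<^sup>2)"
      using J that by (intro member_le_sum) auto
    moreover have "\<phi> t \<ge> 0" by (simp add: \<phi>_def)
    ultimately show ?thesis by (simp add: V_def)
  qed
  have V': "AE t in lebesgue. t > 0 \<longrightarrow> (\<exists>D\<le>- (2 * c) * \<phi> t. (V has_real_derivative D) (at t))"
    using x' \<mu>'
  proof (eventually_elim, intro impI)
    fix t :: real
    assume H: "t > 0 \<longrightarrow> (x has_vector_derivative ?F t) (at t)" "\<forall>j\<in>J. t > 0 \<longrightarrow>
        ((\<lambda>t. \<mu> t j) has_vector_derivative pos_proj (g j (x t)) (\<mu> t j)) (at t)" and t: "t > 0"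
    let ?D = "2 * ((x t - xs) \<bullet> ?F t) +
      (\<Sum>j\<in>J. 2 * ((\<mu> t j - \<mu>s j) \<bullet> pos_proj (g j (x t)) (\<mu> t j)))"
    have "(V has_real_derivative ?D) (at t)"
      unfolding V_def \<phi>_def using H t
      by (intro DERIV_add DERIV_sum has_real_derivative_norm_square) auto
    moreover have "?D = 2 * ((x t - xs) \<bullet> ?F t +
        (\<Sum>j\<in>J. (\<mu> t j - \<mu>s j) * pos_proj (g j (x t)) (\<mu> t j)))"
      by (simp only: inner_real_def sum_distrib_left distrib_left)
    moreover have "2 * ((x t - xs) \<bullet> ?F t +
        (\<Sum>j\<in>J. (\<mu> t j - \<mu>s j) * pos_proj (g j (x t)) (\<mu> t j))) \<le> 2 * (- c * \<phi> t)"
      unfolding \<phi>_def using mono conv kkt comp \<mu>_nonneg t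
      by (intro mult_left_mono saddle_dissipation) auto
    ultimately have "?D \<le> 2 * (- c * \<phi> t)" "(V has_real_derivative ?D) (at t)"
      by (simp_all only:)
    then show "\<exists>D\<le>- (2 * c) * \<phi> t. (V has_real_derivative D) (at t)"
      by (intro exI[of _ ?D] conjI) (simp_all only: mult_minus_left mult_minus_right mult.assoc)
  qed
  have V_le: "V t \<le> V 0" if t: "t \<ge> 0" for t
  proof (cases "t = 0")
    case False
    have "V t - V 0 \<le> 0 * (t - 0)"
    proof (rule abs_continuous_increment_le[OF t])
      show "abs_continuous_on 0 t V" using acV False t by simp
      show "AE t' in lebesgue. t' \<in> {0<..<t} \<longrightarrow> (\<exists>D\<le>0. (V has_real_derivative D) (at t'))"
        using V'
      proof (eventually_elim, intro impI)
        fix t' assume "t' > 0 \<longrightarrow> (\<exists>D\<le>- (2 * c) * \<phi> t'. (V has_real_derivative D) (at t'))"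
          "t' \<in> {0<..<t}"
        then obtain D where "D \<le> - (2 * c) * \<phi> t'" "(V has_real_derivative D) (at t')" by auto
        moreover have "- (2 * c) * \<phi> t' \<le> 0" using c by (simp add: \<phi>_def)
        ultimately show "\<exists>D\<le>0. (V has_real_derivative D) (at t')"
          by (meson order.trans)
      qed
    qed
    then show ?thesis by simp
  qed simp
  \<comment> \<open>By monotonicity of \<open>V\<close>, the state stays within distance \<open>R\<close> of \<open>xs\<close> and each multiplier
    within \<open>R\<close> of \<open>\<mu>s\<close>; \<open>H\<close> dominates the speed there.\<close>
  define R where "R = sqrt (V 0)"
  define H where "H y = norm (Df y) + (\<Sum>j\<in>J. (\<bar>\<mu>s j\<bar> + R) * norm (G j y))" for y
  have R0: "R \<ge> 0" by (simp add: R_def order.trans[OF _ \<phi>_le_V] \<phi>_def)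
  have xR: "norm (x t - xs) \<le> R" if "t \<ge> 0" for t
    unfolding R_def using \<phi>_le_V[of t] V_le[OF that] by (intro real_le_rsqrt) (simp add: \<phi>_def)
  have \<mu>R: "\<bar>\<mu> t j\<bar> \<le> \<bar>\<mu>s j\<bar> + R" if "t \<ge> 0" "j \<in> J" for t j
  proof -
    have "norm (\<mu> t j - \<mu>s j) \<le> R"
      unfolding R_def using \<mu>_le_V[OF that(2), of t] V_le[OF that(1)] by (intro real_le_rsqrt) simp
    then show ?thesis by simp
  qed
  have "continuous_on (cball xs R) H"
    unfolding H_def using contDf contG
    by (intro continuous_intros) (auto intro: continuous_on_subset)
  then have "bounded (H ` cball xs R)"
    by (intro compact_imp_bounded compact_continuous_image) auto
  then obtain B where B: "B > 0" "\<And>y. y \<in> cball xs R \<Longrightarrow> norm (H y) \<le> B"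
    unfolding bounded_pos by auto
  have F_le: "norm (?F t) \<le> B" if t: "t \<ge> 0" for t
  proof -
    have "norm (?F t) \<le> norm (Df (x t)) + (\<Sum>j\<in>J. norm (\<mu> t j *\<^sub>R G j (x t)))"
      unfolding norm_minus_cancel
      by (intro order.trans[OF norm_triangle_ineq] add_left_mono norm_sum)
    also have "\<dots> \<le> H (x t)"
      unfolding H_def using \<mu>R[OF t] by (intro add_left_mono sum_mono) (auto intro: mult_right_mono)
    also have "\<dots> \<le> B"
      using B(2)[of "x t"] xR[OF t] by (simp add: dist_norm norm_minus_commute)
    finally show ?thesis .
  qed
  have "(\<phi> \<longlongrightarrow> 0) at_top"
  proof (rule dissipated_quantity_tendsto_0[OF acV ac\<phi> V'])
    \<comment> \<open>\<open>R + 1\<close> in place of \<open>R\<close> makes the bound positive even for a trajectory at rest.\<close>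
    show "AE t in lebesgue. t > 0 \<longrightarrow> (\<exists>D. \<bar>D\<bar> \<le> 2 * ((R + 1) * B) \<and> (\<phi> has_real_derivative D) (at t))"
      using x'
    proof (eventually_elim, intro impI)
      fix t :: real assume "t > 0 \<longrightarrow> (x has_vector_derivative ?F t) (at t)" "t > 0"
      then have "(\<phi> has_real_derivative 2 * ((x t - xs) \<bullet> ?F t)) (at t)"
        unfolding \<phi>_def by (intro has_real_derivative_norm_square) auto
      moreover have "\<bar>(x t - xs) \<bullet> ?F t\<bar> \<le> (R + 1) * B"
      proof -
        have "\<bar>(x t - xs) \<bullet> ?F t\<bar> \<le> norm (x t - xs) * norm (?F t)"
          by (rule Cauchy_Schwarz_ineq2)
        also have "\<dots> \<le> (R + 1) * B"
          using xR[of t] F_le[of t] R0 \<open>t > 0\<close> by (intro mult_mono) auto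
        finally show ?thesis .
      qed
      ultimately show "\<exists>D. \<bar>D\<bar> \<le> 2 * ((R + 1) * B) \<and> (\<phi> has_real_derivative D) (at t)"
        by (intro exI[of _ "2 * ((x t - xs) \<bullet> ?F t)"]) (simp only: abs_mult abs_numeral, simp)
    qed
    show "0 \<le> V t" for t using \<phi>_le_V[of t] by (auto simp: \<phi>_def intro: order.trans[rotated])
  qed (use c R0 B(1) in \<open>auto simp: \<phi>_def\<close>)
  then have "((\<lambda>t. sqrt (\<phi> t)) \<longlongrightarrow> sqrt 0) at_top" by (rule tendsto_real_sqrt)
  then have "((\<lambda>t. norm (x t - xs)) \<longlongrightarrow> 0) at_top" by (simp add: \<phi>_def)
  then show ?thesis using Lim_null tendsto_norm_zero_iff by blast
qed

section \<open>Affine and band constraints\<close>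

text \<open>
  A function together with its gradient field. The band \<open>(n \<bullet> z + c)\<^sup>2 \<le> s\<^sup>2\<close> describes the
  same set as two affine inequalities; keeping it as one constraint matches the single
  multiplier that the dynamics attach to it.
\<close>

definition affine_or_band :: "('a::real_inner \<Rightarrow> real) \<Rightarrow> ('a \<Rightarrow> 'a) \<Rightarrow> bool" where
  "affine_or_band g G \<longleftrightarrow>
     (\<exists>n c. g = (\<lambda>z. n \<bullet> z + c) \<and> G = (\<lambda>z. n)) \<or>
     (\<exists>n c s. s > 0 \<and> g = (\<lambda>z. (n \<bullet> z + c)\<^sup>2 - s\<^sup>2) \<and> G = (\<lambda>z. (2 * (n \<bullet> z + c)) *\<^sub>R n))"

lemma affine_or_band_GDERIV:
  assumes "affine_or_band g G" shows "GDERIV g z :> G z"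
  using assms unfolding affine_or_band_def gderiv_def
  by (auto intro!: derivative_eq_intros simp: inner_commute algebra_simps)

text \<open>
  For a band the gap in the inequality is exactly \<open>(n \<bullet> (z - y))\<^sup>2\<close>.
\<close>

lemma affine_or_band_convex:
  assumes "affine_or_band g G" shows "g z \<ge> g y + G y \<bullet> (z - y)"
  using assms unfolding affine_or_band_def
proof (elim disjE exE conjE)
  fix n c s assume g: "g = (\<lambda>z. (n \<bullet> z + c)\<^sup>2 - s\<^sup>2)" "G = (\<lambda>z. (2 * (n \<bullet> z + c)) *\<^sub>R n)"
  have "g z - (g y + G y \<bullet> (z - y)) = (n \<bullet> z - n \<bullet> y)\<^sup>2"
    by (simp add: g inner_diff_right power2_eq_square algebra_simps)
  then show ?thesis by (smt (verit) zero_le_power2)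
qed (auto simp: inner_diff_right)

lemma affine_or_band_continuous:
  assumes "affine_or_band g G" shows "continuous_on UNIV G"
  using assms unfolding affine_or_band_def by (auto intro!: continuous_intros)

text \<open>
  An inactive constraint stays inactive by continuity. On the boundary of a band,
  \<open>p = n \<bullet> x + c\<close> equals \<open>s\<close> or \<open>- s\<close> and so is not zero. A first-order nonincreasing
  direction therefore either leaves \<open>n \<bullet> z\<close> unchanged or has a strictly negative first-order
  term, which dominates the quadratic one for short times. With \<open>s = 0\<close> this would fail.
\<close>

lemma affine_or_band_feasible_direction:
  assumes "affine_or_band g G" and gx: "g x \<le> 0" and d: "g x = 0 \<Longrightarrow> d \<bullet> G x \<le> 0"
  shows "\<forall>\<^sub>F t in at_right 0. g (x + t *\<^sub>R d) \<le> 0"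
proof (cases "g x = 0")
  case False
  have "continuous_on UNIV g"
    using assms(1) unfolding affine_or_band_def by (auto intro!: continuous_intros)
  then have "isCont g (x + 0 *\<^sub>R d)" by (simp add: continuous_on_eq_continuous_at)
  then have "isCont (\<lambda>t. g (x + t *\<^sub>R d)) 0"
    by (intro continuous_within_compose3[where f="\<lambda>t. x + t *\<^sub>R d" and g=g] continuous_intros) auto
  then have "((\<lambda>t. g (x + t *\<^sub>R d)) \<longlongrightarrow> g x) (at_right 0)"
    by (auto simp: isCont_def filterlim_at_split)
  then have "\<forall>\<^sub>F t in at_right 0. g (x + t *\<^sub>R d) < 0"
    using gx False by (intro order_tendstoD(2)) auto
  then show ?thesis by eventually_elim simp
next
  case True
  from assms(1) show ?thesis
    unfolding affine_or_band_def
  proof (elim disjE exE conjE)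
    fix n c assume g: "g = (\<lambda>z. n \<bullet> z + c)" "G = (\<lambda>z. n)"
    show ?thesis
      unfolding eventually_at_right_field
    proof (intro exI[of _ 1] conjI allI impI)
      fix t :: real assume "t > 0"
      then have "t * (n \<bullet> d) \<le> 0"
        using d True g by (auto simp: inner_commute mult_nonneg_nonpos)
      then show "g (x + t *\<^sub>R d) \<le> 0" using True by (simp add: g inner_add_right)
    qed simp
  next
    fix n c and s :: real
    assume s: "s > 0" and g: "g = (\<lambda>z. (n \<bullet> z + c)\<^sup>2 - s\<^sup>2)" "G = (\<lambda>z. (2 * (n \<bullet> z + c)) *\<^sub>R n)"
    define p q where "p = n \<bullet> x + c" and "q = n \<bullet> d"
    have p: "p\<^sup>2 = s\<^sup>2" "p \<noteq> 0" using True s by (auto simp: g p_def)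
    have "2 * (p * q) \<le> 0"
      using d[OF True]
      by (simp only: g p_def q_def inner_commute[of d] inner_scaleR_left mult.assoc)
    then have pq: "p * q \<le> 0" by simp
    have step: "g (x + t *\<^sub>R d) = t * (2 * (p * q) + t * q\<^sup>2)" for t
    proof -
      have "g (x + t *\<^sub>R d) = (p + t * q)\<^sup>2 - s\<^sup>2"
        by (simp add: g p_def q_def inner_add_right algebra_simps)
      also have "\<dots> = t * (2 * (p * q) + t * q\<^sup>2)"
        unfolding p(1)[symmetric] by (simp add: power2_eq_square algebra_simps)
      finally show ?thesis .
    qed
    show ?thesis
    proof (cases "q = 0")
      case True
      then show ?thesis by (simp add: step)
    next
      case False
      then have "p * q < 0" using pq p(2) by (simp add: less_le)
      then have pos: "0 < - 2 * (p * q) / q\<^sup>2" using False by (simp add: divide_neg_pos)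
      show ?thesis
        unfolding eventually_at_right_field
      proof (intro exI[of _ "- 2 * (p * q) / q\<^sup>2"] conjI pos allI impI)
        fix t :: real assume t: "t > 0" "t < - 2 * (p * q) / q\<^sup>2"
        then have "2 * (p * q) + t * q\<^sup>2 < 0" using False by (simp add: field_simps)
        then show "g (x + t *\<^sub>R d) \<le> 0" using t by (simp add: step mult_nonneg_nonpos)
      qed
    qed
  qed
qed

theorem saddle_dynamics_converge_to_minimizer:
  fixes f :: "'a::euclidean_space \<Rightarrow> real" and g :: "'j \<Rightarrow> 'a \<Rightarrow> real"
    and x :: "real \<Rightarrow> 'a" and \<mu> :: "real \<Rightarrow> 'j \<Rightarrow> real"
  assumes J: "finite J" and c: "c > 0"
    and f: "\<And>y. GDERIV f y :> Df y" "continuous_on UNIV Df"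
    and mono: "\<And>y z. (Df y - Df z) \<bullet> (y - z) \<ge> c * (norm (y - z))\<^sup>2"
    and g: "\<And>j. j \<in> J \<Longrightarrow> affine_or_band (g j) (G j)"
    and feas: "\<And>j. j \<in> J \<Longrightarrow> g j xs \<le> 0"
    and min: "\<And>y. (\<And>j. j \<in> J \<Longrightarrow> g j y \<le> 0) \<Longrightarrow> f xs \<le> f y"
    and x: "caratheodory x (\<lambda>t. - (Df (x t) + (\<Sum>j\<in>J. \<mu> t j *\<^sub>R G j (x t))))"
    and \<mu>: "\<And>j. j \<in> J \<Longrightarrow> caratheodory (\<lambda>t. \<mu> t j) (\<lambda>t. pos_proj (g j (x t)) (\<mu> t j))"
    and \<mu>0: "\<And>j. j \<in> J \<Longrightarrow> \<mu> 0 j \<ge> 0"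
  shows "(x \<longlongrightarrow> xs) at_top"
proof -
  have "\<exists>\<mu>. (\<forall>j\<in>J. \<mu> j \<ge> 0 \<and> \<mu> j * g j xs = 0) \<and> Df xs + (\<Sum>j\<in>J. \<mu> j *\<^sub>R G j xs) = 0"
    by (rule karush_kuhn_tucker[OF J f(1) feas min affine_or_band_feasible_direction[OF g]])
       (auto intro: feas)
  then obtain \<mu>s where "\<And>j. j \<in> J \<Longrightarrow> \<mu>s j \<ge> 0 \<and> \<mu>s j * g j xs = 0"
    and kkt: "Df xs + (\<Sum>j\<in>J. \<mu>s j *\<^sub>R G j xs) = 0" by auto
  then show ?thesis
    using feas affine_or_band_convex[OF g] affine_or_band_continuous[OF g]
    by (intro saddle_dynamics_converge[OF J c mono _ f(2) _ kkt _ x \<mu> \<mu>0]) auto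
qed


section \<open>Gradient flows on a product and the weighted objective\<close>

lemma caratheodory_Pair:
  assumes "caratheodory x rx" "caratheodory y ry"
  shows "caratheodory (\<lambda>t. (x t, y t)) (\<lambda>t. (rx t, ry t))"
proof -
  have "AE t in lebesgue. t > 0 \<longrightarrow> (x has_vector_derivative rx t) (at t)"
    "AE t in lebesgue. t > 0 \<longrightarrow> (y has_vector_derivative ry t) (at t)"
    using assms by (auto simp: caratheodory_def)
  then have "AE t in lebesgue. t > 0 \<longrightarrow>
      ((\<lambda>t. (x t, y t)) has_vector_derivative (rx t, ry t)) (at t)"
    by eventually_elim (auto intro: has_vector_derivative_Pair)
  then show ?thesis
    using assms by (auto simp: caratheodory_def intro: abs_continuous_on_Pair)
qed

lemma GDERIV_imp_gradient_eq:
  assumes "GDERIV f x :> D"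
  shows "gradient f x = D"
  unfolding gradient_def
proof (rule the_equality)
  fix E assume "GDERIV f x :> E"
  then have "(\<lambda>h. h \<bullet> E) = (\<lambda>h. h \<bullet> D)"
    using assms unfolding gderiv_def by (rule has_derivative_unique)
  then show "E = D" by (metis vector_eq_ldot inner_commute)
qed (rule assms)

text \<open>
  The dynamics use the gradient in one injection with the other held fixed; this and the next
  lemma read it off the gradient on the product space, so the two blocks combine into one
  gradient flow.
\<close>

lemma gradient_fst_component:
  assumes "GDERIV f (x, y) :> D"
  shows "gradient (\<lambda>p. f (p, y)) x = fst D"
proof (rule GDERIV_imp_gradient_eq)
  have "((\<lambda>p. (p, y)) has_derivative (\<lambda>h. (h, 0))) (at x)"
    by (auto intro!: derivative_eq_intros)
  from has_derivative_compose[OF this, of f "\<lambda>h. h \<bullet> D"] show "GDERIV (\<lambda>p. f (p, y)) x :> fst D"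
    using assms by (simp add: gderiv_def inner_prod_def)
qed

lemma gradient_snd_component:
  assumes "GDERIV f (x, y) :> D"
  shows "gradient (\<lambda>p. f (x, p)) y = snd D"
proof (rule GDERIV_imp_gradient_eq)
  have "((\<lambda>p. (x, p)) has_derivative (\<lambda>h. (0, h))) (at y)"
    by (auto intro!: derivative_eq_intros)
  from has_derivative_compose[OF this, of f "\<lambda>h. h \<bullet> D"] show "GDERIV (\<lambda>p. f (x, p)) y :> snd D"
    using assms by (simp add: gderiv_def inner_prod_def)
qed

lemma inner_hadamard:
  fixes W x y :: "real ^ 'b::finite"
  shows "(W * x) \<bullet> y = x \<bullet> (W * y)"
  by (simp add: inner_vec_def algebra_simps)

lemma bounded_linear_hadamard:
  fixes W :: "real ^ 'b::finite"
  shows "bounded_linear (\<lambda>h. W * h)"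
proof -
  have "linear (\<lambda>h. W * h)"
    by (rule linearI) (auto simp: vec_eq_iff algebra_simps)
  then show ?thesis by (simp add: linear_conv_bounded_linear)
qed

lemmas hadamard_continuous = bounded_linear.continuous_on[OF bounded_linear_hadamard]

lemma weighted_square_GDERIV:
  fixes W p q :: "real ^ 'b::finite"
  shows "GDERIV (\<lambda>p. (norm (W * (p - q)))\<^sup>2) p :> 2 *\<^sub>R (W * (W * (p - q)))"
proof -
  have "((\<lambda>p. W * (p - q)) has_derivative (\<lambda>h. W * h)) (at p)"
    by (rule bounded_linear.has_derivative[OF bounded_linear_hadamard]) (auto intro!: derivative_eq_intros)
  then have "((\<lambda>p. (W * (p - q)) \<bullet> (W * (p - q))) has_derivative
      (\<lambda>h. (W * (p - q)) \<bullet> (W * h) + (W * h) \<bullet> (W * (p - q)))) (at p)"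
    by (intro has_derivative_inner)
  moreover have "(W * (p - q)) \<bullet> (W * h) + (W * h) \<bullet> (W * (p - q)) = h \<bullet> (2 *\<^sub>R (W * (W * (p - q))))"
    for h by (simp add: inner_hadamard inner_commute)
  ultimately show ?thesis by (simp add: gderiv_def power2_norm_eq_inner)
qed

lemma weighted_norm_ge:
  fixes W x :: "real ^ 'b::finite"
  assumes "\<And>i. W $ i \<ge> w" "w \<ge> 0"
  shows "(W * (W * x)) \<bullet> x \<ge> w\<^sup>2 * (norm x)\<^sup>2"
proof -
  have "w\<^sup>2 * (x $ i)\<^sup>2 \<le> (W $ i)\<^sup>2 * (x $ i)\<^sup>2" for i
    using assms by (intro mult_right_mono power_mono) auto
  then have "(\<Sum>i\<in>UNIV. w\<^sup>2 * (x $ i)\<^sup>2) \<le> (\<Sum>i\<in>UNIV. (W $ i)\<^sup>2 * (x $ i)\<^sup>2)"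
    by (rule sum_mono)
  moreover have "(norm x)\<^sup>2 = (\<Sum>i\<in>UNIV. (x $ i)\<^sup>2)"
    unfolding power2_norm_eq_inner inner_vec_def by (simp add: power2_eq_square)
  moreover have "(W * (W * x)) \<bullet> x = (\<Sum>i\<in>UNIV. (W $ i)\<^sup>2 * (x $ i)\<^sup>2)"
    by (simp add: inner_vec_def power2_eq_square algebra_simps)
  ultimately show ?thesis by (simp add: sum_distrib_left)
qed

text \<open>
  All partial derivatives are evaluated at the reference injection, so they are constant
  coefficients of the linear terms.
\<close>

lemma lin_power_affine:
  "\<exists>a b. \<forall>P. lin_power N P0 m i j P = a \<bullet> (P (m - 1) - P0) + b \<bullet> P m"
proof -
  define F where "F l = flow N (bus_i N l) (bus_j N l) (admittance N P0 (m - 1))" for l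
  define \<kappa> where "\<kappa> l = partial_deriv (\<lambda>Y. flow N i j Y \<bullet> P0) l (admittance N P0 m) *
     deriv (\<lambda>p. trip (steepness N) p (threshold N (bus_i N l) (bus_j N l))) (F l \<bullet> P0) *
     admittance N P0 (m - 1) $ l" for l
  have "lin_power N P0 m i j P =
      (\<Sum>l\<in>UNIV. \<kappa> l *\<^sub>R F l) \<bullet> (P (m - 1) - P0) + flow N i j (admittance N P0 m) \<bullet> P m" for P
    by (simp add: lin_power_def Let_def inner_sum_left \<kappa>_def F_def)
  then show ?thesis by blast
qed

section \<open>Convergence for the power network\<close>

lemma weighted_square_pair_GDERIV:
  fixes W q :: "real ^ 'b::finite" and z :: "(real ^ 'b) \<times> (real ^ 'b)"
  shows "GDERIV (\<lambda>z. (norm (W * (fst z - q)))\<^sup>2 + (norm (W * (snd z - q)))\<^sup>2) z :>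
           (2 *\<^sub>R (W * (W * (fst z - q))), 2 *\<^sub>R (W * (W * (snd z - q))))"
proof -
  have "((\<lambda>p. (norm (W * (p - q)))\<^sup>2) has_derivative (\<lambda>h. h \<bullet> (2 *\<^sub>R (W * (W * (p - q)))))) (at p)"
    for p using weighted_square_GDERIV[of W q p] by (simp only: gderiv_def)
  from has_derivative_add[OF
      has_derivative_compose[OF has_derivative_fst[OF has_derivative_ident] this]
      has_derivative_compose[OF has_derivative_snd[OF has_derivative_ident] this]]
  show ?thesis by (simp add: gderiv_def inner_prod_def)
qed

text \<open>
  With \<open>weighted_square_pair_GDERIV\<close>, this makes the objective strongly convex with modulus
  \<open>2 w\<^sup>2\<close> for any positive lower bound \<open>w\<close> of the weights.
\<close>

lemma weighted_square_pair_strongly_monotone: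
  fixes W q :: "real ^ 'b::finite" and y z :: "(real ^ 'b) \<times> (real ^ 'b)"
  assumes w: "\<And>i. W $ i \<ge> w" "w \<ge> 0"
  shows "((2 *\<^sub>R (W * (W * (fst y - q))), 2 *\<^sub>R (W * (W * (snd y - q)))) -
          (2 *\<^sub>R (W * (W * (fst z - q))), 2 *\<^sub>R (W * (W * (snd z - q))))) \<bullet> (y - z)
         \<ge> (2 * w\<^sup>2) * (norm (y - z))\<^sup>2" (is "?l \<ge> _")
proof -
  have "2 *\<^sub>R (W * (W * (a - q))) - 2 *\<^sub>R (W * (W * (b - q))) = 2 *\<^sub>R (W * (W * (a - b)))" for a b
    by (simp add: vec_eq_iff algebra_simps)
  then have "?l = 2 * ((W * (W * (fst y - fst z))) \<bullet> (fst y - fst z)) +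
      2 * ((W * (W * (snd y - snd z))) \<bullet> (snd y - snd z))"
    by (simp add: inner_prod_def)
  moreover have "(norm (y - z))\<^sup>2 = (norm (fst y - fst z))\<^sup>2 + (norm (snd y - snd z))\<^sup>2"
    by (simp add: norm_prod_def)
  moreover have "w\<^sup>2 * (norm p)\<^sup>2 \<le> (W * (W * p)) \<bullet> p" for p
    using w by (rule weighted_norm_ge)
  from this[of "fst y - fst z"] this[of "snd y - snd z"]
  have "2 * w\<^sup>2 * ((norm (fst y - fst z))\<^sup>2 + (norm (snd y - snd z))\<^sup>2)
      \<le> 2 * ((W * (W * (fst y - fst z))) \<bullet> (fst y - fst z)) +
        2 * ((W * (W * (snd y - snd z))) \<bullet> (snd y - snd z))"
    by (simp add: distrib_left)
  ultimately show ?thesis by (simp only:)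
qed

theorem proposition4p3:
  fixes N :: "('b::finite, 'l::finite) network"
    and m :: nat
    and W P0 lo hi :: "real ^ 'b"
    and \<sigma> :: "'b \<Rightarrow> 'b \<Rightarrow> real"
    and Pstar :: "nat \<Rightarrow> real ^ 'b"
    and P :: "real \<Rightarrow> nat \<Rightarrow> real ^ 'b"
    and lam :: "real \<Rightarrow> 'b \<Rightarrow> 'b \<Rightarrow> real"
    and \<tau>u \<tau>l :: "real \<Rightarrow> nat \<Rightarrow> 'b \<Rightarrow> real"
  assumes "valid_network N"
    and "m \<ge> 2"
    and "\<And>i. W $ i > 0"
    and "\<And>i j. (i, j) \<in> lines N \<Longrightarrow> \<sigma> i j > 0"
    and "\<And>i. lo $ i \<le> hi $ i"
    and "\<And>i j l. (i, j) \<in> lines N \<Longrightarrow>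
           has_partial (\<lambda>Y. flow N i j Y \<bullet> P0) l (admittance N P0 m)"
    and "\<exists>Q. feasible N P0 m \<sigma> lo hi Q"
    and "is_arg_min (objective W P0 m) (feasible N P0 m \<sigma> lo hi) Pstar"
    and "saddle_solution N W P0 m \<sigma> lo hi P lam \<tau>u \<tau>l"
    and "\<And>i j. (i, j) \<in> lines N \<Longrightarrow> lam 0 i j \<ge> 0"
    and "\<And>k i. k \<in> {m - 1..m} \<Longrightarrow> \<tau>u 0 k i \<ge> 0 \<and> \<tau>l 0 k i \<ge> 0"
  shows "\<forall>k\<in>{m - 1..m}. ((\<lambda>t. P t k) \<longlongrightarrow> Pstar k) at_top"
proof -
  \<comment> \<open>Otherwise the simplifier turns \<open>m - 1\<close> into \<open>m - Suc 0\<close>, away from the form used in the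
    definitions.\<close>
  note One_nat_def [simp del]
  have m1: "m - 1 \<noteq> m" and ms: "{m - 1..m} = {m - 1, m}" using \<open>m \<ge> 2\<close> by auto
  \<comment> \<open>The state is the pair of injections at the steps \<open>m - 1\<close> and \<open>m\<close>; \<open>family\<close> turns it back
    into a family indexed by the step.\<close>
  define family :: "(real ^ 'b) \<times> (real ^ 'b) \<Rightarrow> nat \<Rightarrow> real ^ 'b"
    where "family z k = (if k = m then snd z else fst z)" for z k
  have family_simps: "family z m = snd z" "family z (m - 1) = fst z" for z
    using m1 by (auto simp: family_def)
  have lin_power_cong: "lin_power N P0 m i j Q = lin_power N P0 m i j R"
    if "Q (m - 1) = R (m - 1)" "Q m = R m" for i j Q R
    using that by (simp add: lin_power_def)
  \<comment> \<open>Line, upper and lower constraints are indexed by a disjoint sum, so sums over all constraints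
    split into the three parts of the Lagrangian.\<close>
  define J :: "('b \<times> 'b + (nat \<times> 'b + nat \<times> 'b)) set"
    where "J = lines N <+> ({m - 1..m} \<times> UNIV <+> {m - 1..m} \<times> UNIV)"
  have J: "finite J" by (simp add: J_def)
  define g :: "'b \<times> 'b + (nat \<times> 'b + nat \<times> 'b) \<Rightarrow> (real ^ 'b) \<times> (real ^ 'b) \<Rightarrow> real"
    where "g = case_sum (\<lambda>(i, j) z. (lin_power N P0 m i j (family z))\<^sup>2 - (\<sigma> i j)\<^sup>2)
      (case_sum (\<lambda>(k, i) z. family z k $ i - hi $ i) (\<lambda>(k, i) z. lo $ i - family z k $ i))"
  define \<mu> :: "real \<Rightarrow> 'b \<times> 'b + (nat \<times> 'b + nat \<times> 'b) \<Rightarrow> real"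
    where "\<mu> t = case_sum (\<lambda>(i, j). lam t i j)
      (case_sum (\<lambda>(k, i). \<tau>u t k i) (\<lambda>(k, i). \<tau>l t k i))" for t
  define f :: "(real ^ 'b) \<times> (real ^ 'b) \<Rightarrow> real"
    where "f z = (norm (W * (fst z - P0)))\<^sup>2 + (norm (W * (snd z - P0)))\<^sup>2" for z
  define Df :: "(real ^ 'b) \<times> (real ^ 'b) \<Rightarrow> (real ^ 'b) \<times> (real ^ 'b)"
    where "Df z = (2 *\<^sub>R (W * (W * (fst z - P0))), 2 *\<^sub>R (W * (W * (snd z - P0))))" for z
  have "\<exists>G. affine_or_band (g c) G" if c: "c \<in> J" for c
  proof -
    consider i j where "c = Inl (i, j)" "(i, j) \<in> lines N"
      | k i where "c = Inr (Inl (k, i))" | k i where "c = Inr (Inr (k, i))"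
      using c by (auto simp: J_def)
    then show ?thesis
    proof cases
      case 1
      obtain a b where ab: "\<And>Q. lin_power N P0 m i j Q = a \<bullet> (Q (m - 1) - P0) + b \<bullet> Q m"
        using lin_power_affine by blast
      have "g c = (\<lambda>z. ((a, b) \<bullet> z + - (a \<bullet> P0))\<^sup>2 - (\<sigma> i j)\<^sup>2)"
        by (auto simp: 1 g_def ab family_simps inner_prod_def inner_diff_right algebra_simps)
      then show ?thesis
        unfolding affine_or_band_def using assms(4)[OF 1(2)] by blast
    next
      case 2
      have "g c = (\<lambda>z. (if k = m then (0, axis i 1) else (axis i 1, 0)) \<bullet> z + - (hi $ i))"
        by (auto simp: 2 g_def family_def inner_prod_def inner_axis')
      then show ?thesis unfolding affine_or_band_def by blast
    next
      case 3
      have "g c = (\<lambda>z. (- (if k = m then (0, axis i 1) else (axis i 1, 0))) \<bullet> z + lo $ i)"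
        by (auto simp: 3 g_def family_def inner_prod_def inner_axis')
      then show ?thesis unfolding affine_or_band_def by blast
    qed
  qed
  then obtain G where G: "\<And>c. c \<in> J \<Longrightarrow> affine_or_band (g c) (G c)" by metis
  have lin_power_family: "lin_power N P0 m i j (family (Q (m - 1), Q m)) = lin_power N P0 m i j Q" for i j Q
    by (rule lin_power_cong) (simp_all add: family_simps)
  have family_step: "family (Q (m - 1), Q m) k = Q k" if "k \<in> {m - 1..m}" for Q k
    using that m1 unfolding ms by (auto simp: family_def)
  have feasible_iff: "feasible N P0 m \<sigma> lo hi Q \<longleftrightarrow> (\<forall>c\<in>J. g c (Q (m - 1), Q m) \<le> 0)" for Q
    using family_step[of _ Q] by (fastforce simp: feasible_def J_def g_def Ball_def lin_power_family)
  have objective_eq: "objective W P0 m Q = f (Q (m - 1), Q m)" for Q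
    using m1 by (simp add: objective_def ms f_def)
  have Df: "GDERIV f z :> Df z" for z
    unfolding f_def Df_def by (rule weighted_square_pair_GDERIV)
  define L where "L t z = f z + (\<Sum>c\<in>J. \<mu> t c * g c z)" for t z
  have DL: "GDERIV (L t) z :> Df z + (\<Sum>c\<in>J. \<mu> t c *\<^sub>R G c z)" for t z
  proof -
    have "((\<lambda>z. \<mu> t c * g c z) has_derivative (\<lambda>h. h \<bullet> (\<mu> t c *\<^sub>R G c z))) (at z)" if "c \<in> J" for c
      using affine_or_band_GDERIV[OF G[OF that], of z] unfolding gderiv_def
      by (auto intro!: derivative_eq_intros)
    then show ?thesis
      using Df[of z] unfolding L_def gderiv_def inner_add_right inner_sum_right
      by (intro has_derivative_add has_derivative_sum) auto
  qed
  have L: "lagrangian N W P0 m \<sigma> lo hi Q (lam t) (\<tau>u t) (\<tau>l t) = L t (Q (m - 1), Q m)" for Q t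
  proof -
    have "(\<Sum>k\<in>{m - 1, m}. \<Sum>i\<in>UNIV. \<tau>u t k i * (Q k $ i - hi $ i) + \<tau>l t k i * (lo $ i - Q k $ i))
      = (\<Sum>(k, i)\<in>{m - 1, m} \<times> UNIV. \<tau>u t k i * (family (Q (m - 1), Q m) k $ i - hi $ i)) +
        (\<Sum>(k, i)\<in>{m - 1, m} \<times> UNIV. \<tau>l t k i * (lo $ i - family (Q (m - 1), Q m) k $ i))"
      using m1 by (simp add: sum.cartesian_product[symmetric] sum.distrib family_def)
    moreover have "(\<Sum>k\<in>{m - 1, m}. (norm (W * (Q k - P0)))\<^sup>2) = f (Q (m - 1), Q m)"
      using m1 by (simp add: f_def)
    ultimately show ?thesis
      unfolding lagrangian_def ms L_def J_def
      by (simp add: sum.Plus \<mu>_def g_def case_prod_unfold lin_power_family)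
  qed
  define x where "x t = (P t (m - 1), P t m)" for t
  have sol: "saddle_solution N W P0 m \<sigma> lo hi P lam \<tau>u \<tau>l" by fact
  have "gradient (\<lambda>p. L t (p, P t m)) (P t (m - 1)) = fst (Df (x t) + (\<Sum>c\<in>J. \<mu> t c *\<^sub>R G c (x t)))"
    "gradient (\<lambda>p. L t (P t (m - 1), p)) (P t m) = snd (Df (x t) + (\<Sum>c\<in>J. \<mu> t c *\<^sub>R G c (x t)))"
    for t
    unfolding x_def by (rule gradient_fst_component[OF DL] gradient_snd_component[OF DL])+
  then have "caratheodory (\<lambda>t. P t (m - 1)) (\<lambda>t. - fst (Df (x t) + (\<Sum>c\<in>J. \<mu> t c *\<^sub>R G c (x t))))"
    "caratheodory (\<lambda>t. P t m) (\<lambda>t. - snd (Df (x t) + (\<Sum>c\<in>J. \<mu> t c *\<^sub>R G c (x t))))"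
    using sol m1 unfolding saddle_solution_def ms L by (auto simp del: fst_add snd_add)
  from caratheodory_Pair[OF this]
  have x: "caratheodory x (\<lambda>t. - (Df (x t) + (\<Sum>c\<in>J. \<mu> t c *\<^sub>R G c (x t))))"
    by (simp add: x_def[abs_def] uminus_prod_def)
  have \<mu>': "caratheodory (\<lambda>t. \<mu> t c) (\<lambda>t. pos_proj (g c (x t)) (\<mu> t c))" if "c \<in> J" for c
  proof -
    show ?thesis
      using that sol family_step[of _ "P _"]
      unfolding saddle_solution_def J_def g_def \<mu>_def x_def by (auto simp: lin_power_family)
  qed
  have \<mu>0: "\<mu> 0 c \<ge> 0" if "c \<in> J" for c
    using that assms(10,11) by (auto simp: J_def \<mu>_def)
  define w where "w = Min (range (($) W))"
  have w: "w > 0" "\<And>i. W $ i \<ge> w" using assms(3) by (auto simp: w_def)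
  have mono: "(Df y - Df z) \<bullet> (y - z) \<ge> (2 * w\<^sup>2) * (norm (y - z))\<^sup>2" for y z
    unfolding Df_def using w by (intro weighted_square_pair_strongly_monotone) auto
  have contDf: "continuous_on UNIV Df"
    unfolding Df_def by (intro continuous_on_Pair hadamard_continuous continuous_intros)
  define xs where "xs = (Pstar (m - 1), Pstar m)"
  have feas: "\<forall>c\<in>J. g c xs \<le> 0"
    using assms(8) feasible_iff[of Pstar] by (simp add: is_arg_min_def xs_def)
  have opt: "f xs \<le> f z" if "\<And>c. c \<in> J \<Longrightarrow> g c z \<le> 0" for z
  proof -
    have "feasible N P0 m \<sigma> lo hi (family z)"
      using that feasible_iff[of "family z"] by (simp add: family_simps)
    then have "objective W P0 m Pstar \<le> objective W P0 m (family z)"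
      using assms(8) by (auto simp: is_arg_min_def not_less)
    then show ?thesis by (simp add: objective_eq family_simps xs_def)
  qed
  have "(x \<longlongrightarrow> xs) at_top"
    using w(1) by (intro saddle_dynamics_converge_to_minimizer[OF J _ Df contDf mono G _ opt x \<mu>' \<mu>0])
      (use feas in auto)
  then have "((\<lambda>t. P t (m - 1)) \<longlongrightarrow> Pstar (m - 1)) at_top" "((\<lambda>t. P t m) \<longlongrightarrow> Pstar m) at_top"
    using tendsto_fst tendsto_snd by (fastforce simp: x_def xs_def)+
  then show ?thesis unfolding ms by simp
qed

end
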